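(* Let $G$ be a non-elementary GBS group and $V<G$ a non-trivial elliptic subgroup. (1) If $G'<G$ is a subgroup of finite index and $V\subset G'$, then $\mathcal{D}(G,V)=\mathcal{D}(G',V)$. (2) If $V'<V$ with $[V:V']=r$ (a positive integer), then $\mathcal{D}(G,V')=\{\,n/\gcd(r,n)\mid n\in\mathcal{D}(G,V)\,\}$.
   Context: A generalized Baumslag–Solitar (GBS) group is a group $G$ acting without inversions on a simplicial tree with all vertex and edge stabilizers infinite cyclic; such a tree is a GBS tree for $G$. (GBS groups are not required to be finitely generated.) A finite-index subgroup of a GBS group is a GBS group. A GBS group is elementary if it is isomorphic to $\mathbb{Z}$, $\mathbb{Z}\times\mathbb{Z}$, or the Klein bottle group, or is the union of an infinitely ascending chain of infinite cyclic groups $C_0\subset C_1\subset C_2\subset\cdots$; otherwise it is non-elementary. An element $g\in G$ (or a subgroup) is elliptic if it fixes a vertex of a GBS tree; an element that is not elliptic is hyperbolic. For non-elementary $G$ these notions do not depend on the choice of GBS tree. Modular homomorphism: fix a non-trivial elliptic element $a\in G$. Every $g\in G$ satisfies $g^{-1}a^mg=a^n$ for some non-zero integers $m,n$, and $q(g)=m/n$ defines a homomorphism $q\colon G\to\mathbb{Q}^\times$, independent of $a$ (and, for non-elementary $G$, of the GBS tree). Depth profile: write $V^g=gVg^{-1}$. For a non-trivial elliptic subgroup $V<G$, the $V$-depth of $g\in G$ is $D_V(g)=[V:V\cap V^g]$. The depth profile is $$\mathcal{D}(G,V)=\{D_V(g)\mid g\in G\text{ is hyperbolic and }q(g)=\pm1\}\subset\mathbb{N}.$$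 *)

theory Defs
  imports Complex_Main "HOL-Algebra.Group_Action" "HOL-Algebra.Elementary_Groups"
begin

section \<open>Trees and GBS trees\<close>

definition adjacency :: "'v set set \<Rightarrow> 'v rel" where
  "adjacency E = {(u, v). {u, v} \<in> E}"

text \<open>Trees may be infinite, and not locally finite.\<close>

locale simplicial_tree =
  fixes X :: "'v set" and E :: "'v set set"
  assumes nonempty: "X \<noteq> {}"
    and edges: "e \<in> E \<Longrightarrow> e \<subseteq> X \<and> card e = 2"
    and connected: "\<lbrakk>u \<in> X; v \<in> X\<rbrakk> \<Longrightarrow> (u, v) \<in> (adjacency E)\<^sup>*"
    and no_cycle: "\<not> (\<exists>p. 3 \<le> length p \<and> distinct p \<and>
      (\<forall>i<length p. {p ! i, p ! (Suc i mod length p)} \<in> E))"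

definition infinite_cyclic_subgroup :: "'a set \<Rightarrow> ('a, 'b) monoid_scheme \<Rightarrow> bool" where
  "infinite_cyclic_subgroup H G \<longleftrightarrow> subgroup H G \<and> G\<lparr>carrier := H\<rparr> \<cong> integer_group"

locale gbs_tree = group_action G X \<phi> + simplicial_tree X E
  for G (structure) and X :: "'v set" and E :: "'v set set"
    and \<phi> :: "'a \<Rightarrow> 'v \<Rightarrow> 'v" +
  assumes edge_image: "\<lbrakk>g \<in> carrier G; e \<in> E\<rbrakk> \<Longrightarrow> \<phi> g ` e \<in> E"
    and no_inversion: "\<lbrakk>g \<in> carrier G; {u, v} \<in> E\<rbrakk> \<Longrightarrow> \<not> (\<phi> g u = v \<and> \<phi> g v = u)"
    and vertex_stabilizer: "x \<in> X \<Longrightarrow> infinite_cyclic_subgroup (stabilizer G \<phi> x) G"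
    and edge_stabilizer:
      "e \<in> E \<Longrightarrow> infinite_cyclic_subgroup {g \<in> carrier G. \<phi> g ` e = e} G"


section \<open>GBS groups\<close>

text \<open>
  The trees quantified over below have vertices in the type of the elements of \<^term>\<open>G\<close>. This
  is no restriction: by the lemma \<open>gbs_tree_change_type\<close> at the end, the elements and subsets of
  \<^term>\<open>G\<close> fixing a vertex of a GBS tree with vertices in any other type are the same.
\<close>

definition gbs_group :: "('a, 'b) monoid_scheme \<Rightarrow> bool" where
  "gbs_group G \<longleftrightarrow> (\<exists>(X :: 'a set) E \<phi>. gbs_tree G X E \<phi>)"

text \<open>The pair \<open>(n, m)\<close> stands for $b^n a^m$ in $\langle a, b \mid a b a^{-1} = b^{-1}\rangle$.\<close>

definition klein_bottle_group :: "(int \<times> int) monoid" where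
  "klein_bottle_group = \<lparr>carrier = UNIV,
    monoid.mult = (\<lambda>(n, m) (n', m'). (n + (if even m then n' else - n'), m + m')),
    one = (0, 0)\<rparr>"

lemma group_klein_bottle_group: "group klein_bottle_group"
proof (rule groupI)
  fix x assume "x \<in> carrier klein_bottle_group"
  obtain n m where "x = (n, m)" by (cases x)
  then show "\<exists>y\<in>carrier klein_bottle_group.
      y \<otimes>\<^bsub>klein_bottle_group\<^esub> x = \<one>\<^bsub>klein_bottle_group\<^esub>"
    by (intro bexI[of _ "(if even m then - n else n, - m)"]) (auto simp: klein_bottle_group_def)
qed (auto simp: klein_bottle_group_def)

definition elementary :: "('a, 'b) monoid_scheme \<Rightarrow> bool" where
  "elementary G \<longleftrightarrow>
     G \<cong> integer_group \<or> G \<cong> integer_group \<times>\<times> integer_group \<or> G \<cong> klein_bottle_group \<or>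
     (\<exists>C :: nat \<Rightarrow> 'a set. (\<forall>i. infinite_cyclic_subgroup (C i) G) \<and>
        (\<forall>i. C i \<subset> C (Suc i)) \<and> carrier G = (\<Union>i. C i))"

definition elliptic :: "('a, 'b) monoid_scheme \<Rightarrow> 'a \<Rightarrow> bool" where
  "elliptic G g \<longleftrightarrow>
     (\<exists>(X :: 'a set) E \<phi>. gbs_tree G X E \<phi> \<and> (\<exists>x\<in>X. g \<in> stabilizer G \<phi> x))"

definition elliptic_subgroup :: "'a set \<Rightarrow> ('a, 'b) monoid_scheme \<Rightarrow> bool" where
  "elliptic_subgroup H G \<longleftrightarrow> subgroup H G \<and>
     (\<exists>(X :: 'a set) E \<phi>. gbs_tree G X E \<phi> \<and> (\<exists>x\<in>X. H \<subseteq> stabilizer G \<phi> x))"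

definition hyperbolic :: "('a, 'b) monoid_scheme \<Rightarrow> 'a \<Rightarrow> bool" where
  "hyperbolic G g \<longleftrightarrow> g \<in> carrier G \<and> \<not> elliptic G g"

text \<open>
  For non-elementary \<^term>\<open>G\<close> the value \<open>r\<close> exists and does not depend on the choice of \<open>a\<close>,
  \<open>m\<close> and \<open>n\<close>.
\<close>

definition modular :: "('a, 'b) monoid_scheme \<Rightarrow> 'a \<Rightarrow> rat" where
  "modular G g = (THE r. \<exists>a (m :: int) (n :: int).
     elliptic G a \<and> a \<noteq> \<one>\<^bsub>G\<^esub> \<and> m \<noteq> 0 \<and> n \<noteq> 0 \<and>
     inv\<^bsub>G\<^esub> g \<otimes>\<^bsub>G\<^esub> (a [^]\<^bsub>G\<^esub> m) \<otimes>\<^bsub>G\<^esub> g = a [^]\<^bsub>G\<^esub> n \<and>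
     r = of_int m / of_int n)"


section \<open>Depth profile\<close>

definition conjugate :: "('a, 'b) monoid_scheme \<Rightarrow> 'a set \<Rightarrow> 'a \<Rightarrow> 'a set" where
  "conjugate G V g = g <#\<^bsub>G\<^esub> V #>\<^bsub>G\<^esub> inv\<^bsub>G\<^esub> g"

text \<open>The value is 0 if the index is infinite.\<close>

definition subgroup_index :: "('a, 'b) monoid_scheme \<Rightarrow> 'a set \<Rightarrow> 'a set \<Rightarrow> nat" where
  "subgroup_index G H K = card (rcosets\<^bsub>G\<lparr>carrier := H\<rparr>\<^esub> K)"

definition depth :: "('a, 'b) monoid_scheme \<Rightarrow> 'a set \<Rightarrow> 'a \<Rightarrow> nat" where
  "depth G V g = subgroup_index G V (V \<inter> conjugate G V g)"

definition depth_profile :: "('a, 'b) monoid_scheme \<Rightarrow> 'a set \<Rightarrow> nat set" where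
  "depth_profile G V =
     {depth G V g | g. hyperbolic G g \<and> (modular G g = 1 \<or> modular G g = - 1)}"

section \<open>Independence of the vertex type\<close>

lemma group_actionI:
  assumes "group G"
    and ext: "\<And>g. g \<in> carrier G \<Longrightarrow> \<psi> g \<in> extensional Y"
    and clo: "\<And>g y. \<lbrakk>g \<in> carrier G; y \<in> Y\<rbrakk> \<Longrightarrow> \<psi> g y \<in> Y"
    and one: "\<And>y. y \<in> Y \<Longrightarrow> \<psi> \<one>\<^bsub>G\<^esub> y = y"
    and mult: "\<And>g h y. \<lbrakk>g \<in> carrier G; h \<in> carrier G; y \<in> Y\<rbrakk> \<Longrightarrow>
      \<psi> (g \<otimes>\<^bsub>G\<^esub> h) y = \<psi> g (\<psi> h y)"
  shows "group_action G Y \<psi>"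
proof -
  interpret group G by fact
  have bij: "\<psi> g \<in> Bij Y" if g: "g \<in> carrier G" for g
  proof -
    have 1: "\<psi> (inv\<^bsub>G\<^esub> g) (\<psi> g y) = y" "\<psi> g (\<psi> (inv\<^bsub>G\<^esub> g) y) = y" if "y \<in> Y" for y
      using that g mult[of "inv\<^bsub>G\<^esub> g" g y] mult[of g "inv\<^bsub>G\<^esub> g" y] one by auto
    have "bij_betw (\<psi> g) Y Y"
      by (rule bij_betw_byWitness[where f' = "\<psi> (inv\<^bsub>G\<^esub> g)"]) (use 1 g clo in auto)
    then show ?thesis using ext[OF g] by (auto simp: Bij_def)
  qed
  have "\<psi> \<in> hom G (BijGroup Y)"
  proof (rule homI)
    fix g h assume gh: "g \<in> carrier G" "h \<in> carrier G"
    have "\<psi> (g \<otimes>\<^bsub>G\<^esub> h) = compose Y (\<psi> g) (\<psi> h)"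
      using gh by (intro extensionalityI[of _ Y]) (auto simp: ext mult compose_eq)
    then show "\<psi> (g \<otimes>\<^bsub>G\<^esub> h) = \<psi> g \<otimes>\<^bsub>BijGroup Y\<^esub> \<psi> h"
      using gh bij by (simp add: BijGroup_def)
  qed (use bij in \<open>auto simp: BijGroup_def\<close>)
  then show ?thesis
    by (simp add: group_action_def group_hom_def group_hom_axioms_def group_BijGroup assms(1))
qed

lemma adjacency_rtrancl_mono: "A \<subseteq> B \<Longrightarrow> (adjacency A)\<^sup>* \<subseteq> (adjacency B)\<^sup>*"
  by (rule rtrancl_mono) (auto simp: adjacency_def)

lemma adjacency_rtrancl_sym: "(u, v) \<in> (adjacency A)\<^sup>* \<Longrightarrow> (v, u) \<in> (adjacency A)\<^sup>*"
  by (rule symD[OF sym_rtrancl]) (auto simp: adjacency_def sym_def insert_commute)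

lemma adjacency_rtrancl_image:
  assumes "(u, v) \<in> (adjacency A)\<^sup>*" and "\<And>e. e \<in> A \<Longrightarrow> f ` e \<in> B"
  shows "(f u, f v) \<in> (adjacency B)\<^sup>*"
  using assms(1)
proof induction
  case (step y z)
  then have "(f y, f z) \<in> adjacency B" using assms(2)[of "{y, z}"] by (simp add: adjacency_def)
  with step.IH show ?case by (rule rtrancl_into_rtrancl)
qed simp

lemma finite_walk:
  assumes "(x, y) \<in> (adjacency E)\<^sup>*"
  shows "\<exists>S. finite S \<and> x \<in> S \<and> y \<in> S \<and> (\<forall>z\<in>S. (x, z) \<in> (adjacency {e \<in> E. e \<subseteq> S})\<^sup>*)"
  using assms
proof induction
  case base
  show ?case by (rule exI[of _ "{x}"]) auto
next
  case (step y z)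
  then obtain S where S: "finite S" "x \<in> S" "y \<in> S"
    "\<forall>z\<in>S. (x, z) \<in> (adjacency {e \<in> E. e \<subseteq> S})\<^sup>*" by blast
  let ?E = "{e \<in> E. e \<subseteq> insert z S}"
  have 1: "(x, w) \<in> (adjacency ?E)\<^sup>*" if "w \<in> S" for w
    using S(4) that adjacency_rtrancl_mono[of "{e \<in> E. e \<subseteq> S}" ?E] by blast
  moreover have "(y, z) \<in> adjacency ?E" using step.hyps(2) S(3) by (auto simp: adjacency_def)
  ultimately have "(x, z) \<in> (adjacency ?E)\<^sup>*" using S(3) by (meson rtrancl_into_rtrancl)
  with 1 S show ?case by (intro exI[of _ "insert z S"]) auto
qed

lemma (in gbs_tree) phi_in: "\<lbrakk>g \<in> carrier G; x \<in> X\<rbrakk> \<Longrightarrow> \<phi> g x \<in> X"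
  using element_image by blast

lemma (in gbs_tree) phi_one: "x \<in> X \<Longrightarrow> \<phi> \<one> x = x"
  using id_eq_one by (metis restrict_apply')

lemma (in gbs_tree) is_group_G: "group G"
  using group_hom by (simp add: group_hom_def)

lemma (in gbs_tree) gbs_subtree:
  assumes Y: "Y \<subseteq> X" "Y \<noteq> {}" and inv: "\<And>g y. \<lbrakk>g \<in> carrier G; y \<in> Y\<rbrakk> \<Longrightarrow> \<phi> g y \<in> Y"
    and con: "\<And>u v. \<lbrakk>u \<in> Y; v \<in> Y\<rbrakk> \<Longrightarrow> (u, v) \<in> (adjacency {e \<in> E. e \<subseteq> Y})\<^sup>*"
  shows "gbs_tree G Y {e \<in> E. e \<subseteq> Y} (\<lambda>g. restrict (\<phi> g) Y)"
proof -
  interpret G: group G by (rule is_group_G)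
  have im: "restrict (\<phi> g) Y ` e = \<phi> g ` e" if "e \<subseteq> Y" for g e
    using that by (intro image_cong) auto
  have "group_action G Y (\<lambda>g. restrict (\<phi> g) Y)"
    using Y inv by (intro group_actionI) (auto simp: G.is_group phi_one composition_rule subset_iff)
  moreover have "simplicial_tree Y {e \<in> E. e \<subseteq> Y}"
  proof
    show "\<not> (\<exists>p. 3 \<le> length p \<and> distinct p \<and>
      (\<forall>i<length p. {p ! i, p ! (Suc i mod length p)} \<in> {e \<in> E. e \<subseteq> Y}))"
      using no_cycle by blast
  qed (use Y edges con in auto)
  moreover have "gbs_tree_axioms G Y {e \<in> E. e \<subseteq> Y} (\<lambda>g. restrict (\<phi> g) Y)"
  proof
    fix g e assume "g \<in> carrier G" "e \<in> {e \<in> E. e \<subseteq> Y}"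
    then show "restrict (\<phi> g) Y ` e \<in> {e \<in> E. e \<subseteq> Y}"
      using edge_image inv by (auto simp: im subset_iff)
  next
    fix g u v assume "g \<in> carrier G" "{u, v} \<in> {e \<in> E. e \<subseteq> Y}"
    then show "\<not> (restrict (\<phi> g) Y u = v \<and> restrict (\<phi> g) Y v = u)"
      using no_inversion by auto
  next
    fix y assume y: "y \<in> Y"
    then have "stabilizer G (\<lambda>g. restrict (\<phi> g) Y) y = stabilizer G \<phi> y"
      by (auto simp: stabilizer_def)
    then show "infinite_cyclic_subgroup (stabilizer G (\<lambda>g. restrict (\<phi> g) Y) y) G"
      using vertex_stabilizer y Y by auto
  next
    fix e assume "e \<in> {e \<in> E. e \<subseteq> Y}"
    then have e: "e \<in> E" "e \<subseteq> Y" by auto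
    show "infinite_cyclic_subgroup {g \<in> carrier G. restrict (\<phi> g) Y ` e = e} G"
      using edge_stabilizer[OF e(1)] by (simp only: im[OF e(2)])
  qed
  ultimately show ?thesis by (simp add: gbs_tree_def)
qed

lemma (in gbs_tree) gbs_tree_transport:
  fixes f :: "'v \<Rightarrow> 'w"
  assumes f: "inj_on f X"
  defines "\<psi> \<equiv> \<lambda>g. \<lambda>y\<in>f ` X. f (\<phi> g (the_inv_into X f y))"
  shows "gbs_tree G (f ` X) ((`) f ` E) \<psi>"
    and "x \<in> X \<Longrightarrow> stabilizer G \<psi> (f x) = stabilizer G \<phi> x"
proof -
  interpret G: group G by (rule is_group_G)
  have psi: "\<psi> g (f x) = f (\<phi> g x)" if "x \<in> X" for g x
    using that f by (simp add: \<psi>_def the_inv_into_f_f)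
  have feq: "f u = f v \<longleftrightarrow> u = v" if "u \<in> X" "v \<in> X" for u v
    using f that by (auto dest: inj_onD)
  have EX: "e \<subseteq> X" if "e \<in> E" for e using edges that by blast
  have im: "\<psi> g ` f ` e = f ` \<phi> g ` e" if "e \<in> E" for g e
    using EX[OF that] unfolding image_image by (intro image_cong refl psi) auto
  have fE: "f ` e \<in> (`) f ` E \<longleftrightarrow> e \<in> E" if "e \<subseteq> X" for e
    using that EX f by (auto simp: inj_on_image_eq_iff)
  have stab: "stabilizer G \<psi> (f x) = stabilizer G \<phi> x" if "x \<in> X" for x
    using that by (auto simp: stabilizer_def psi feq phi_in)
  then show "x \<in> X \<Longrightarrow> stabilizer G \<psi> (f x) = stabilizer G \<phi> x" .
  have "group_action G (f ` X) \<psi>"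
  proof (rule group_actionI)
    show "\<psi> g \<in> extensional (f ` X)" for g by (simp add: \<psi>_def)
  qed (auto simp: G.is_group psi phi_one phi_in composition_rule)
  moreover have "simplicial_tree (f ` X) ((`) f ` E)"
  proof
    show "f ` X \<noteq> {}" using nonempty by simp
  next
    fix e assume "e \<in> (`) f ` E"
    then show "e \<subseteq> f ` X \<and> card e = 2"
      using edges f by (auto simp: card_image inj_on_subset)
  next
    fix u v assume "u \<in> f ` X" "v \<in> f ` X"
    then obtain u' v' where uv: "u' \<in> X" "v' \<in> X" "u = f u'" "v = f v'" by blast
    show "(u, v) \<in> (adjacency ((`) f ` E))\<^sup>*"
      unfolding uv(3,4) by (rule adjacency_rtrancl_image[OF connected[OF uv(1,2)]]) simp
  next
    show "\<not> (\<exists>p. 3 \<le> length p \<and> distinct p \<and>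
      (\<forall>i<length p. {p ! i, p ! (Suc i mod length p)} \<in> (`) f ` E))"
    proof
      assume "\<exists>p. 3 \<le> length p \<and> distinct p \<and>
        (\<forall>i<length p. {p ! i, p ! (Suc i mod length p)} \<in> (`) f ` E)"
      then obtain p where p: "3 \<le> length p" "distinct p"
        "\<And>i. i < length p \<Longrightarrow> {p ! i, p ! (Suc i mod length p)} \<in> (`) f ` E" by blast
      have "set p \<subseteq> f ` X"
      proof
        fix y assume "y \<in> set p"
        then obtain i where i: "i < length p" "y = p ! i" by (auto simp: in_set_conv_nth)
        with p(3)[of i] EX show "y \<in> f ` X" by blast
      qed
      then have "p \<in> lists (f ` X)" by (simp add: in_lists_conv_set subset_iff)
      then have "p \<in> map f ` lists X" by (simp only: lists_image)
      then obtain q where q: "set q \<subseteq> X" "p = map f q" by auto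
      have "{q ! i, q ! (Suc i mod length q)} \<in> E" if i: "i < length q" for i
      proof -
        have j: "Suc i mod length q < length q" using i by (intro mod_less_divisor) auto
        have "f ` {q ! i, q ! (Suc i mod length q)} \<in> (`) f ` E"
          using p(3)[of i] i j by (simp add: q(2))
        moreover have "{q ! i, q ! (Suc i mod length q)} \<subseteq> X" using q(1) i j by auto
        ultimately show ?thesis using fE by blast
      qed
      moreover have "distinct q" using p(2) q(2) by (simp add: distinct_map)
      ultimately show False using no_cycle p(1) q(2) by auto
    qed
  qed
  moreover have "gbs_tree_axioms G (f ` X) ((`) f ` E) \<psi>"
  proof
    fix g e assume "g \<in> carrier G" "e \<in> (`) f ` E"
    then show "\<psi> g ` e \<in> (`) f ` E" using edge_image by (auto simp: im)
  next
    fix g u v assume g: "g \<in> carrier G" and uv: "{u, v} \<in> (`) f ` E"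
    then have "u \<in> f ` X" "v \<in> f ` X" using EX by blast+
    then obtain u' v' where uv': "u' \<in> X" "v' \<in> X" "u = f u'" "v = f v'" by blast
    then have "{u', v'} \<in> E" using uv fE[of "{u', v'}"] by simp
    then show "\<not> (\<psi> g u = v \<and> \<psi> g v = u)"
      using no_inversion[OF g, of u' v'] uv' g by (simp add: psi feq phi_in)
  next
    fix y assume "y \<in> f ` X"
    then show "infinite_cyclic_subgroup (stabilizer G \<psi> y) G"
      using vertex_stabilizer by (auto simp: stab)
  next
    fix e assume "e \<in> (`) f ` E"
    then obtain e' where e': "e' \<in> E" "e = f ` e'" by blast
    have "\<psi> g ` e = e \<longleftrightarrow> \<phi> g ` e' = e'" if "g \<in> carrier G" for g
      unfolding e'(2) im[OF e'(1)]
      by (rule inj_on_image_eq_iff[OF f EX[OF edge_image[OF that e'(1)]] EX[OF e'(1)]])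
    then have "{g \<in> carrier G. \<psi> g ` e = e} = {g \<in> carrier G. \<phi> g ` e' = e'}" by blast
    then show "infinite_cyclic_subgroup {g \<in> carrier G. \<psi> g ` e = e} G"
      using edge_stabilizer e'(1) by simp
  qed
  ultimately show "gbs_tree G (f ` X) ((`) f ` E) \<psi>" by (simp add: gbs_tree_def)
qed

theorem gbs_tree_change_type:
  fixes G :: "('a, 'b) monoid_scheme" and X :: "'v set"
  assumes "gbs_tree G X E \<phi>" and x: "x \<in> X"
  shows "\<exists>(Y :: 'a set) F \<psi>. gbs_tree G Y F \<psi> \<and>
    (\<exists>y\<in>Y. stabilizer G \<psi> y = stabilizer G \<phi> x)"
proof -
  interpret gbs_tree G X E \<phi> by fact
  interpret G: group G by (rule is_group_G)
  have "\<forall>g\<in>carrier G. \<exists>S. finite S \<and> x \<in> S \<and> \<phi> g x \<in> S \<and>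
      (\<forall>z\<in>S. (x, z) \<in> (adjacency {e \<in> E. e \<subseteq> S})\<^sup>*)"
    using x by (intro ballI finite_walk connected phi_in)
  from bchoice[OF this] obtain S where S: "\<And>g. g \<in> carrier G \<Longrightarrow> finite (S g)"
    "\<And>g. g \<in> carrier G \<Longrightarrow> x \<in> S g" "\<And>g. g \<in> carrier G \<Longrightarrow> \<phi> g x \<in> S g"
    "\<And>g z. \<lbrakk>g \<in> carrier G; z \<in> S g\<rbrakk> \<Longrightarrow> (x, z) \<in> (adjacency {e \<in> E. e \<subseteq> S g})\<^sup>*"
    by blast
  have SX: "S g \<subseteq> X" if g: "g \<in> carrier G" for g
  proof
    fix z assume "z \<in> S g"
    from S(4)[OF g this] show "z \<in> X"
    proof (cases rule: rtranclE)
      case base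
      with x show ?thesis by simp
    next
      case (step y)
      then have "{y, z} \<in> E" by (simp add: adjacency_def)
      with edges show ?thesis by blast
    qed
  qed
  define Y where "Y = (\<Union>h\<in>carrier G. \<Union>g\<in>carrier G. \<phi> h ` S g)"
  have xY: "x \<in> Y"
    unfolding Y_def using S(2)[of "\<one>\<^bsub>G\<^esub>"] phi_one[OF x]
    by (auto intro!: bexI[of _ "\<one>\<^bsub>G\<^esub>"] image_eqI[of _ _ x])
  have YX: "Y \<subseteq> X" unfolding Y_def using SX phi_in by blast
  have inv_Y: "\<phi> k y \<in> Y" if k: "k \<in> carrier G" and y: "y \<in> Y" for k y
  proof -
    obtain h g s where hgs: "h \<in> carrier G" "g \<in> carrier G" "s \<in> S g" "y = \<phi> h s"
      using y by (auto simp: Y_def)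
    then have "\<phi> k y = \<phi> (k \<otimes>\<^bsub>G\<^esub> h) s" using k SX composition_rule by (metis subsetD)
    then show ?thesis unfolding Y_def using hgs k by blast
  qed
  let ?F = "{e \<in> E. e \<subseteq> Y}"
  have walk: "(\<phi> h x, \<phi> h s) \<in> (adjacency ?F)\<^sup>*"
    if hgs: "h \<in> carrier G" "g \<in> carrier G" "s \<in> S g" for h g s
  proof (rule adjacency_rtrancl_image[OF S(4)[OF hgs(2,3)]])
    fix e assume "e \<in> {e \<in> E. e \<subseteq> S g}"
    moreover have "\<phi> h ` S g \<subseteq> Y" unfolding Y_def using hgs by blast
    ultimately show "\<phi> h ` e \<in> ?F" using edge_image hgs by blast
  qed
  have walk_x: "(x, y) \<in> (adjacency ?F)\<^sup>*" if y: "y \<in> Y" for y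
  proof -
    obtain h g s where hgs: "h \<in> carrier G" "g \<in> carrier G" "s \<in> S g" "y = \<phi> h s"
      using y by (auto simp: Y_def)
    have "(x, \<phi> h x) \<in> (adjacency ?F)\<^sup>*"
      using walk[of "\<one>\<^bsub>G\<^esub>" h "\<phi> h x"] hgs(1) S(3) x by (simp add: phi_one phi_in)
    with walk[OF hgs(1-3)] show ?thesis unfolding hgs(4) by (rule rtrancl_trans[rotated])
  qed
  have "gbs_tree G Y ?F (\<lambda>g. restrict (\<phi> g) Y)"
  proof (rule gbs_subtree)
    fix u v assume "u \<in> Y" "v \<in> Y"
    then show "(u, v) \<in> (adjacency ?F)\<^sup>*"
      using walk_x adjacency_rtrancl_sym by (meson rtrancl_trans)
  qed (use xY YX inv_Y in auto)
  then interpret Y: gbs_tree G Y ?F "\<lambda>g. restrict (\<phi> g) Y" .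
  have "infinite (carrier G)"
  proof
    assume fin: "finite (carrier G)"
    let ?H = "stabilizer G \<phi> x"
    have "infinite_cyclic_subgroup ?H G" using vertex_stabilizer x .
    then obtain f where f: "f \<in> iso (G\<lparr>carrier := ?H\<rparr>) integer_group"
      by (auto simp: infinite_cyclic_subgroup_def is_iso_def)
    have "f ` ?H = (UNIV :: int set)" using f by (auto simp: iso_def bij_betw_def)
    moreover have "finite ?H" using fin by (simp add: stabilizer_def)
    ultimately show False by (metis finite_imageI infinite_UNIV_int)
  qed
  then have "(card_of (\<phi> h ` S g), card_of (carrier G)) \<in> ordLeq"
    if "h \<in> carrier G" "g \<in> carrier G" for h g
    using that S(1) by (intro ordLess_imp_ordLeq finite_ordLess_infinite) (auto simp: Field_card_of card_of_well_order_on)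
  with \<open>infinite (carrier G)\<close> have "(card_of Y, card_of (carrier G)) \<in> ordLeq"
    unfolding Y_def
    by (intro card_of_UNION_ordLeq_infinite ballI ordLeq_refl[OF card_of_Card_order])
  then obtain f where "inj_on f Y" "f ` Y \<subseteq> carrier G" using card_of_ordLeq[of Y "carrier G"] by blast
  note tr = Y.gbs_tree_transport[OF this(1)]
  have "stabilizer G (\<lambda>g. restrict (\<phi> g) Y) x = stabilizer G \<phi> x"
    using xY by (auto simp: stabilizer_def)
  with tr(1) tr(2)[OF xY] xY show ?thesis by blast
qed

end

theory Submission
  imports Defs
begin

text \<open>
  Let \<open>T\<close> be a GBS tree with \<open>V = \<langle>v\<rangle>\<close> fixing a vertex. If \<open>q(g) = \<plusminus>1\<close>, then \<open>v\<^sup>k \<in> gVg\<inverse>\<close> holds iff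
  \<open>g\<inverse>v\<^sup>kg = v\<^sup>\<plusminus>\<^sup>k\<close>, and these \<open>k\<close> are the multiples of the depth of \<open>g\<close>. This gives (2), since passing
  to \<open>v\<^sup>r\<close> replaces the exponents divisible by \<open>n\<close> by those \<open>k\<close> with \<open>n\<close> dividing \<open>rk\<close>.

  For (1) it is enough to find, for a hyperbolic \<open>g\<close> of depth \<open>n\<close>, another one all of whose positive
  powers have depth \<open>n\<close>, since some power lies in \<open>G'\<close>. The depth may drop for powers of \<open>g\<close>, but not
  if a vertex fixed by \<open>v\<close> is on the axis of \<open>g\<close>. This is arranged by multiplying \<open>g\<close> by elements
  centralizing \<open>v\<close>.

  Ellipticity does not depend on the tree, nor on passing to \<open>G'\<close>: an element \<open>b\<close> that is elliptic in a
  \<open>G'\<close>-tree is commensurated by \<open>G'\<close>, so if \<open>b\<close> were hyperbolic in \<open>T\<close>, the group \<open>G\<close> would preserve its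
  axis, and would then be \<open>\<int> \<times> \<int>\<close> or the Klein bottle group.
\<close>

section \<open>Metric geometry of trees\<close>

text \<open>Why a vertex \<open>y\<close> fixed by \<open>v\<close> on the axis of \<open>h\<close>
  keeps the depth from dropping: if \<open>h^j\<close> conjugates \<open>v^l\<close> to a power of
  \<open>v\<close>, then \<open>v^l\<close> fixes \<open>y\<close> and \<open>h^j y\<close>, hence
  also \<open>h y\<close> between them, so conjugating \<open>v^l\<close> by \<open>h\<close> gives
  an element of the stabilizer of \<open>y\<close>. That group is infinite cyclic and contains
  \<open>v\<close>. Since \<open>h\<close> sends some non-zero power of \<open>v\<close> to itself
  or its inverse, comparing exponents shows that it already does so with \<open>v^l\<close>. The
  obstacle is that the vertices fixed by \<open>v\<close> may all lie off the axis of
  \<open>g\<close>; minimizing displacement over the fixed vertex and the replacement of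
  \<open>g\<close> together removes it. The two elementary groups arise because a group preserving a
  line acts on it by translations and by reflections in vertices, with infinite cyclic kernel; a
  reflection in an edge would be an inversion. The modulus enters only through one criterion:
  \<open>q(g)\<close> is 1 or -1 iff conjugation by \<open>g\<close> sends some non-zero power of
  \<open>v\<close> to itself or its inverse.\<close>

context simplicial_tree
begin

lemma edge_in: "{u, v} \<in> E \<Longrightarrow> u \<in> X" "{u, v} \<in> E \<Longrightarrow> v \<in> X"
  using edges by blast+

lemma edge_neq: "{u, v} \<in> E \<Longrightarrow> u \<noteq> v"
  using edges[of "{u, v}"] by auto

text \<open>The value is unspecified when no walk joins the two vertices, hence the premises of the
  form \<open>u \<in> X\<close> below.\<close>

definition tdist :: "'v \<Rightarrow> 'v \<Rightarrow> nat" where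
  "tdist u v = (LEAST n. (u, v) \<in> adjacency E ^^ n)"

lemma tdist_walk: "\<lbrakk>u \<in> X; v \<in> X\<rbrakk> \<Longrightarrow> (u, v) \<in> adjacency E ^^ tdist u v"
  unfolding tdist_def using rtrancl_imp_relpow[OF connected] by (metis LeastI)

lemma tdist_le: "(u, v) \<in> adjacency E ^^ n \<Longrightarrow> tdist u v \<le> n"
  unfolding tdist_def by (rule Least_le)

lemma adjacency_relpow_sym: "(u, v) \<in> adjacency E ^^ n \<Longrightarrow> (v, u) \<in> adjacency E ^^ n"
proof (induction n arbitrary: u)
  case (Suc n)
  then obtain w where "(u, w) \<in> adjacency E" "(w, v) \<in> adjacency E ^^ n"
    by (meson relpow_Suc_D2)
  then have "(v, w) \<in> adjacency E ^^ n" "(w, u) \<in> adjacency E"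
    using Suc.IH by (auto simp: adjacency_def insert_commute)
  then show ?case by (rule relpow_Suc_I)
qed auto

lemma tdist_sym: "\<lbrakk>u \<in> X; v \<in> X\<rbrakk> \<Longrightarrow> tdist u v = tdist v u"
  by (metis antisym tdist_le adjacency_relpow_sym tdist_walk)

lemma tdist_self [simp]: "tdist u u = 0"
  using tdist_le[of u u 0] by simp

lemma tdist_eq_0: "\<lbrakk>u \<in> X; v \<in> X\<rbrakk> \<Longrightarrow> tdist u v = 0 \<longleftrightarrow> u = v"
  using tdist_walk[of u v] by auto

lemma tdist_triangle:
  assumes "u \<in> X" "v \<in> X" "w \<in> X"
  shows "tdist u w \<le> tdist u v + tdist v w"
  using assms by (intro tdist_le) (auto simp: relpow_add intro: tdist_walk)

lemma tdist_edge: "{u, v} \<in> E \<Longrightarrow> tdist u v = 1"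
  using tdist_le[of u v 1] tdist_eq_0[of u v] edge_in[of u v] edge_neq[of u v]
  by (auto simp: adjacency_def le_Suc_eq)

lemma tdist_edge_le:
  assumes "{u, w} \<in> E" "v \<in> X"
  shows "tdist u v \<le> Suc (tdist w v)"
  using tdist_triangle[of u w v] tdist_edge[OF assms(1)] edge_in[OF assms(1)] assms(2) by simp

lemma closer_neighbor:
  assumes "u \<in> X" "v \<in> X" "u \<noteq> v"
  obtains w where "{u, w} \<in> E" "tdist u v = Suc (tdist w v)"
proof -
  have "tdist u v \<noteq> 0" using assms by (simp add: tdist_eq_0)
  then obtain n where n: "tdist u v = Suc n" using not0_implies_Suc by blast
  then have "(u, v) \<in> adjacency E ^^ Suc n" using tdist_walk[of u v] assms by simp
  then obtain w where w: "(u, w) \<in> adjacency E" "(w, v) \<in> adjacency E ^^ n"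
    by (meson relpow_Suc_D2)
  then have 1: "{u, w} \<in> E" by (simp add: adjacency_def)
  have "tdist u v = Suc (tdist w v)"
    using tdist_le[OF w(2)] tdist_edge_le[OF 1 assms(2)] n by linarith
  with 1 that show thesis by blast
qed

lemma geodesic:
  assumes "u \<in> X" "v \<in> X"
  obtains f where "f 0 = u" "f (tdist u v) = v"
    "\<And>i. i < tdist u v \<Longrightarrow> {f i, f (Suc i)} \<in> E"
    "\<And>i. i \<le> tdist u v \<Longrightarrow> f i \<in> X \<and> tdist (f i) v = tdist u v - i"
proof -
  have "\<exists>f. f 0 = u \<and> f (tdist u v) = v \<and> (\<forall>i<tdist u v. {f i, f (Suc i)} \<in> E) \<and>
     (\<forall>i\<le>tdist u v. f i \<in> X \<and> tdist (f i) v = tdist u v - i)"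
    using assms(1)
  proof (induction "tdist u v" arbitrary: u)
    case 0
    then have "u = v" using assms(2) by (metis tdist_eq_0)
    then show ?case using 0 by (intro exI[of _ "\<lambda>_. u"]) auto
  next
    case (Suc n)
    then have "u \<noteq> v" by auto
    then obtain w where w: "{u, w} \<in> E" "tdist u v = Suc (tdist w v)"
      using closer_neighbor[of u v] Suc.prems assms(2) by blast
    with Suc.hyps have n: "n = tdist w v" by simp
    from Suc.hyps(1)[OF n] edge_in(2)[OF w(1)] obtain f where f: "f 0 = w" "f n = v"
      "\<forall>i<n. {f i, f (Suc i)} \<in> E" "\<forall>i\<le>n. f i \<in> X \<and> tdist (f i) v = n - i"
      unfolding n by blast
    show ?case
    proof (intro exI[of _ "case_nat u f"] conjI allI impI)
      fix i assume i: "i < tdist u v"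
      then show "{case_nat u f i, case_nat u f (Suc i)} \<in> E"
        using w(1) f(1,3) Suc.hyps(2) by (cases i) auto
    next
      fix i assume i: "i \<le> tdist u v"
      show "case_nat u f i \<in> X" using i Suc.prems f(4) Suc.hyps(2) by (cases i) auto
      show "tdist (case_nat u f i) v = tdist u v - i"
        using i f(4) w(2) Suc.hyps(2) by (cases i) auto
    qed (use f(2) Suc.hyps(2)[symmetric] in auto)
  qed
  then show thesis using that by blast
qed

lemma tdist_along_walk:
  assumes f: "f 0 \<in> X" "\<And>i. i < N \<Longrightarrow> {f i, f (Suc i)} \<in> E"
  shows "i \<le> N \<Longrightarrow> f i \<in> X \<and> tdist (f 0) (f i) \<le> i"
proof (induction i)
  case (Suc i)
  then have e: "{f i, f (Suc i)} \<in> E" using f(2) by simp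
  then have "f (Suc i) \<in> X" "f i \<in> X" using edge_in by auto
  with Suc show ?case
    using tdist_triangle[OF f(1), of "f i" "f (Suc i)"] tdist_edge[OF e] by auto
qed (use f in simp)

text \<open>A shortest closed subwalk has distinct vertices. Its length is not 1, since an edge has
  two ends, and not 2, since the walk does not backtrack; so it is a cycle excluded by
  \<open>no_cycle\<close>.\<close>

lemma reduced_walk_not_closed:
  fixes f :: "nat \<Rightarrow> 'v"
  assumes edge: "\<And>i. i < N \<Longrightarrow> {f i, f (Suc i)} \<in> E"
    and red: "\<And>i. Suc (Suc i) \<le> N \<Longrightarrow> f i \<noteq> f (Suc (Suc i))"
    and N: "0 < N"
  shows "f 0 \<noteq> f N"
proof
  assume "f 0 = f N"
  define Q where "Q = (\<lambda>k. 0 < k \<and> (\<exists>i. i + k \<le> N \<and> f i = f (i + k)))"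
  define k where "k = (LEAST k. Q k)"
  have "Q N" unfolding Q_def using \<open>f 0 = f N\<close> N by auto
  then have "Q k" unfolding k_def by (rule LeastI)
  then obtain i where i: "0 < k" "i + k \<le> N" "f i = f (i + k)" unfolding Q_def by blast
  have min: "k \<le> l" if "Q l" for l unfolding k_def using that by (rule Least_le)
  have "k \<noteq> 1" using i edge[of i] edge_neq[of "f i" "f (Suc i)"] by auto
  moreover have "k \<noteq> 2" using i red[of i] by auto
  ultimately have k3: "3 \<le> k" using i(1) by linarith
  define p where "p = map (\<lambda>j. f (i + j)) [0..<k]"
  have len: "length p = k" by (simp add: p_def)
  have "distinct p"
  proof -
    have "a = b" if ab: "a < k" "b < k" "f (i + a) = f (i + b)" "a \<le> b" for a b
    proof (rule ccontr)
      assume "a \<noteq> b"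
      with ab i(2) have "Q (b - a)" unfolding Q_def by (auto intro!: exI[of _ "i + a"])
      from min[OF this] ab \<open>a \<noteq> b\<close> show False by linarith
    qed
    then have "inj_on (\<lambda>j. f (i + j)) {0..<k}"
      by (intro inj_onI) (metis atLeastLessThan_iff nat_le_linear)
    then show ?thesis by (simp add: p_def distinct_map)
  qed
  moreover have "{p ! j, p ! (Suc j mod length p)} \<in> E" if j: "j < length p" for j
  proof (cases "Suc j < k")
    case True
    then show ?thesis using edge[of "i + j"] i(2) by (simp add: p_def)
  next
    case False
    then have "Suc j = k" using j len by simp
    then show ?thesis using edge[of "i + j"] i by (auto simp: p_def)
  qed
  ultimately show False using no_cycle k3 len by blast
qed

text \<open>Acyclicity in metric form; it is not used in any other way below.\<close>

lemma farther_neighbor: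
  assumes "{x, z} \<in> E" "{x, w} \<in> E" "y \<in> X" "z \<noteq> w" "tdist x y = Suc (tdist z y)"
  shows "tdist w y = Suc (tdist x y)"
proof (rule ccontr)
  assume neq: "tdist w y \<noteq> Suc (tdist x y)"
  have XX: "x \<in> X" "z \<in> X" "w \<in> X" using edge_in assms(1,2) by auto
  have "tdist w y \<le> Suc (tdist x y)"
    using tdist_edge_le[of w x y] assms(2,3) by (simp add: insert_commute)
  with neq have le: "tdist w y \<le> tdist x y" by simp
  define n m where "n = tdist z y" and "m = tdist w y"
  obtain p where p: "p 0 = z" "p n = y" "\<And>i. i < n \<Longrightarrow> {p i, p (Suc i)} \<in> E"
    "\<And>i. i \<le> n \<Longrightarrow> p i \<in> X \<and> tdist (p i) y = n - i"
    using geodesic[OF XX(2) assms(3)] unfolding n_def by blast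
  obtain q where q: "q 0 = w" "q m = y" "\<And>i. i < m \<Longrightarrow> {q i, q (Suc i)} \<in> E"
    "\<And>i. i \<le> m \<Longrightarrow> q i \<in> X \<and> tdist (q i) y = m - i"
    using geodesic[OF XX(3) assms(3)] unfolding m_def by blast
  \<comment> \<open>\<open>W\<close> runs backwards along \<open>p\<close> from \<open>y\<close> to
    \<open>z\<close>, passes through \<open>x\<close> and \<open>w\<close> at positions
    \<open>n + 1\<close> and \<open>n + 2\<close>, and follows \<open>q\<close> back to
    \<open>y\<close>. It is a closed walk, and the negated claim makes it reduced.\<close>
  define W where "W = (\<lambda>i. if i \<le> n then p (n - i) else if i = Suc n then x else q (i - n - 2))"
  have x: "tdist x y = Suc n" "m \<le> Suc n" using assms(5) le by (auto simp: n_def m_def)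
  have "W 0 \<noteq> W (n + m + 2)"
  proof (rule reduced_walk_not_closed)
    fix i assume i: "i < n + m + 2"
    consider "i < n" | "i = n" | "i = Suc n" | "n + 2 \<le> i" by linarith
    then show "{W i, W (Suc i)} \<in> E"
    proof cases
      case 1
      then have "n - i = Suc (n - Suc i)" by simp
      then show ?thesis using 1 p(3)[of "n - Suc i"] by (simp add: W_def insert_commute)
    next
      case 4
      then have "Suc i - n - 2 = Suc (i - n - 2)" "i - n - 2 < m" using i by auto
      then show ?thesis using 4 q(3)[of "i - n - 2"] by (simp add: W_def)
    qed (use p(1) q(1) assms(1,2) in \<open>auto simp: W_def insert_commute\<close>)
  next
    fix i assume i: "Suc (Suc i) \<le> n + m + 2"
    consider "i + 2 \<le> n" | "Suc i = n" | "i = n" | "i = Suc n" | "n + 2 \<le> i" by linarith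
    then show "W i \<noteq> W (Suc (Suc i))"
    proof cases
      case 1
      then have "tdist (W i) y \<noteq> tdist (W (Suc (Suc i))) y"
        using p(4)[of "n - i"] p(4)[of "n - Suc (Suc i)"] by (simp add: W_def)
      then show ?thesis by auto
    next
      case 2
      then have "tdist (W i) y \<noteq> tdist (W (Suc (Suc i))) y"
        using p(4)[of 1] x by (auto simp: W_def)
      then show ?thesis by auto
    next
      case 3
      then show ?thesis using assms(4) p(1) q(1) by (simp add: W_def)
    next
      \<comment> \<open>The walk goes from \<open>x\<close>, at distance \<open>n + 1\<close> from
        \<open>y\<close>, to \<open>q 1\<close>, at distance \<open>m - 1\<close>. These differ
        because \<open>m \<le> n + 1\<close>, which is the negated claim.\<close>
      case 4
      then have "tdist (W i) y \<noteq> tdist (W (Suc (Suc i))) y"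
        using q(4)[of 1] x i by (auto simp: W_def)
      then show ?thesis by auto
    next
      case 5
      then have "Suc (Suc i) - n - 2 = Suc (Suc (i - n - 2))" "Suc (Suc (i - n - 2)) \<le> m"
        using i by auto
      with 5 have "tdist (W i) y \<noteq> tdist (W (Suc (Suc i))) y"
        using q(4)[of "i - n - 2"] q(4)[of "Suc (Suc (i - n - 2))"] by (simp add: W_def)
      then show ?thesis by auto
    qed
  qed simp
  moreover have "W 0 = y" "W (n + m + 2) = y" using p(2) q(2) by (auto simp: W_def)
  ultimately show False by simp
qed

lemma closer_neighbor_unique:
  assumes "{x, z} \<in> E" "{x, w} \<in> E" "y \<in> X" "tdist x y = Suc (tdist z y)"
    "tdist x y = Suc (tdist w y)"
  shows "z = w"
  using farther_neighbor[OF assms(1-3)] assms(4,5) by force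

text \<open>The first steps from \<open>a\<close> towards \<open>c\<close> and towards
  \<open>c'\<close> both come closer to \<open>b\<close>, so they coincide by
  \<open>closer_neighbor_unique\<close>; this drives an induction on the distance from
  \<open>a\<close>.\<close>

lemma geodesic_point_unique:
  assumes "a \<in> X" "b \<in> X" "c \<in> X" "c' \<in> X"
    and "tdist a c + tdist c b = tdist a b" "tdist a c' + tdist c' b = tdist a b"
    and "tdist a c = tdist a c'"
  shows "c = c'"
  using assms(1,5-)
proof (induction "tdist a c" arbitrary: a)
  case 0
  then show ?case using assms(3,4) by (metis tdist_eq_0)
next
  case (Suc n)
  have ne: "a \<noteq> c" "a \<noteq> c'" using Suc.hyps(2) Suc.prems by auto
  obtain u where u: "{a, u} \<in> E" "tdist a c = Suc (tdist u c)"
    using closer_neighbor[OF Suc.prems(1) assms(3) ne(1)] .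
  obtain u' where u': "{a, u'} \<in> E" "tdist a c' = Suc (tdist u' c')"
    using closer_neighbor[OF Suc.prems(1) assms(4) ne(2)] .
  have uX: "u \<in> X" "u' \<in> X" using u u' edge_in by auto
  have 1: "tdist a b = Suc (tdist u b)"
    using tdist_triangle[OF uX(1) assms(3,2)] tdist_edge_le[OF u(1) assms(2)] u(2) Suc.prems by linarith
  have 2: "tdist a b = Suc (tdist u' b)"
    using tdist_triangle[OF uX(2) assms(4,2)] tdist_edge_le[OF u'(1) assms(2)] u'(2) Suc.prems by linarith
  have "u = u'" using closer_neighbor_unique[OF u(1) u'(1) assms(2) 1 2] .
  then show ?case
    using Suc.hyps Suc.prems u u' 1 by (intro Suc.hyps(1)[OF _ uX(1)]) auto
qed

section \<open>Bi-infinite lines and projection onto them\<close>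

definition line :: "(int \<Rightarrow> 'v) \<Rightarrow> bool" where
  "line P \<longleftrightarrow> (\<forall>i. {P i, P (i + 1)} \<in> E \<and> P i \<noteq> P (i + 2))"

lemma line_in: "line P \<Longrightarrow> P i \<in> X"
  using edge_in unfolding line_def by blast

text \<open>Having moved away from \<open>z\<close>, the line cannot turn back: the vertex it came
  from is the only closer neighbour, and a line does not backtrack. The second claim runs one step
  ahead so that the induction knows the direction of the last step.\<close>

lemma ray_tdist:
  assumes P: "line P" and z: "z \<in> X" and far: "tdist z (P (i + 1)) = Suc (tdist z (P i))"
  shows "tdist z (P (i + int n)) = tdist z (P i) + n"
    and "tdist z (P (i + int n + 1)) = tdist z (P i) + n + 1"
proof (induction n)
  case (Suc n)
  have e: "{P (i + int n + 1), P (i + int n)} \<in> E" "{P (i + int n + 1), P (i + int n + 2)} \<in> E"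
    using P unfolding line_def by (metis insert_commute, metis add.assoc one_add_one)
  have "tdist (P (i + int n + 2)) z = Suc (tdist (P (i + int n + 1)) z)"
  proof (rule farther_neighbor[OF e z])
    show "P (i + int n) \<noteq> P (i + int n + 2)" using P unfolding line_def by blast
    show "tdist (P (i + int n + 1)) z = Suc (tdist (P (i + int n)) z)"
      using Suc P z line_in tdist_sym by (metis Suc_eq_plus1)
  qed
  then have "tdist z (P (i + int n + 2)) = Suc (tdist z (P (i + int n + 1)))"
    using P z line_in tdist_sym by metis
  then show "tdist z (P (i + int (Suc n))) = tdist z (P i) + Suc n"
    "tdist z (P (i + int (Suc n) + 1)) = tdist z (P i) + Suc n + 1"
    using Suc by (simp_all add: algebra_simps)
qed (use far in auto)

lemma line_reverse: "line P \<Longrightarrow> line (\<lambda>i. P (c - i))"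
proof -
  assume P: "line P"
  have "{P (c - i), P (c - (i + 1))} \<in> E" for i
    using P[unfolded line_def, rule_format, of "c - (i + 1)"] by (simp add: insert_commute)
  moreover have "P (c - i) \<noteq> P (c - (i + 2))" for i
    using P[unfolded line_def, rule_format, of "c - (i + 2)"] by force
  ultimately show ?thesis unfolding line_def by blast
qed

text \<open>\<open>P i\<close> is a vertex of the line at least distance \<open>s\<close> from
  \<open>z\<close>. Both rays leaving it start by moving away from \<open>z\<close>, and
  \<open>ray_tdist\<close> shows that they continue to do so.\<close>

lemma line_projection:
  assumes P: "line P" and z: "z \<in> X"
  obtains i s where "\<And>j. int (tdist z (P j)) = int s + \<bar>j - i\<bar>" "tdist z (P i) = s"
proof -
  define s where "s = (LEAST s. \<exists>i. tdist z (P i) = s)"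
  have "\<exists>i. tdist z (P i) = s" unfolding s_def by (rule LeastI_ex) auto
  then obtain i where i: "tdist z (P i) = s" by blast
  have min: "s \<le> tdist z (P j)" for j unfolding s_def by (rule Least_le) blast
  \<comment> \<open>Stated for every line inside the image of \<open>P\<close>, so that it applies
    to \<open>P\<close> and to its reversal. If \<open>s\<close> is not 0, the neighbour of
    \<open>Q k\<close> towards \<open>z\<close> is nearer than \<open>s\<close> and therefore off
    the line.\<close>
  have step: "tdist z (Q (k + 1)) = Suc (tdist z (Q k))"
    if Q: "line Q" and k: "tdist z (Q k) = s" and sub: "range Q \<subseteq> range P" for Q k
  proof (cases "s = 0")
    case True
    then have "z = Q k" using k z Q line_in tdist_eq_0 by metis
    then show ?thesis using Q tdist_edge unfolding line_def by fastforce
  next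
    case False
    have ne: "Q k \<noteq> z" using False k by auto
    obtain w where w: "{Q k, w} \<in> E" "tdist (Q k) z = Suc (tdist w z)"
      using closer_neighbor[OF line_in[OF Q] z ne] .
    have s': "s \<le> tdist z (Q l)" for l
    proof -
      obtain l' where "Q l = P l'" using sub by blast
      then show ?thesis using min by simp
    qed
    have "w \<noteq> Q (k + 1)"
    proof
      assume "w = Q (k + 1)"
      then show False using w s'[of "k + 1"] k z tdist_sym line_in[OF Q]
        by (metis not_less_eq_eq order_refl)
    qed
    then have "tdist (Q (k + 1)) z = Suc (tdist (Q k) z)"
      using farther_neighbor[OF w(1) _ z _ w(2)] Q unfolding line_def by blast
    then show ?thesis using z line_in[OF Q] tdist_sym by metis
  qed
  have "int (tdist z (P j)) = int s + \<bar>j - i\<bar>" for j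
  proof (cases "i \<le> j")
    case True
    then have "tdist z (P (i + int (nat (j - i)))) = s + nat (j - i)"
      using ray_tdist(1)[OF P z step[OF P i order_refl]] i by metis
    with True show ?thesis by simp
  next
    case False
    define Q where "Q = (\<lambda>l. P (0 - l))"
    have Q: "line Q" unfolding Q_def by (rule line_reverse[OF P])
    have k: "tdist z (Q (- i)) = s" by (simp add: Q_def i)
    have "range Q \<subseteq> range P" by (auto simp: Q_def)
    then have "tdist z (Q (- i + int (nat (i - j)))) = s + nat (i - j)"
      using ray_tdist(1)[OF Q z step[OF Q k]] k by metis
    with False show ?thesis by (simp add: Q_def)
  qed
  with i that show thesis by blast
qed

text \<open>The conditions in \<open>line\<close> are local; projecting a vertex of the line onto
  the line turns them into this global statement, as the nearest distance must then be 0.\<close>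

lemma line_tdist:
  assumes P: "line P"
  shows "int (tdist (P i) (P j)) = \<bar>i - j\<bar>"
proof -
  obtain k s where k: "\<And>j. int (tdist (P i) (P j)) = int s + \<bar>j - k\<bar>"
    using line_projection[OF P line_in[OF P]] by blast
  have "0 = int s + \<bar>i - k\<bar>" using k[of i] unfolding tdist_self by simp
  then have "int s = 0" "k = i" by linarith+
  then show ?thesis using k[of j] by linarith
qed

lemma line_inj: "line P \<Longrightarrow> P i = P j \<longleftrightarrow> i = j"
  using line_tdist[of P i j] by auto

text \<open>Seen from \<open>P i\<close>, the vertex \<open>z'\<close> lies in the direction of a
  neighbour on the line, because \<open>i'\<close> differs from \<open>i\<close>. The geodesic from
  \<open>P i\<close> to \<open>z\<close> starts with another edge, so each of its steps moves away
  from \<open>z'\<close>.\<close>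

lemma tdist_across_line:
  assumes P: "line P" and z: "z \<in> X" and z': "z' \<in> X"
    and i: "\<And>j. int (tdist z (P j)) = int s + \<bar>j - i\<bar>"
    and i': "\<And>j. int (tdist z' (P j)) = int s' + \<bar>j - i'\<bar>" and neq: "i \<noteq> i'"
  shows "int (tdist z z') = int s + int s' + \<bar>i - i'\<bar>"
proof -
  have s: "tdist (P i) z = s" using i[of i] tdist_sym[OF z line_in[OF P]] by simp
  obtain f where f: "f 0 = P i" "f s = z" "\<And>k. k < s \<Longrightarrow> {f k, f (Suc k)} \<in> E"
    "\<And>k. k \<le> s \<Longrightarrow> f k \<in> X \<and> tdist (f k) z = s - k"
    using geodesic[OF line_in[OF P, of i] z] unfolding s by blast
  define j where "j = (if i < i' then i + 1 else i - 1)"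
  have j: "{P i, P j} \<in> E" "\<bar>j - i'\<bar> + 1 = \<bar>i - i'\<bar>" "\<bar>j - i\<bar> = 1"
    using P[unfolded line_def, rule_format, of i] P[unfolded line_def, rule_format, of "i - 1"] neq
    by (auto simp: j_def insert_commute)
  have sym: "tdist z' (P l) = tdist (P l) z'" "tdist z (P l) = tdist (P l) z" for l
    using z z' line_in[OF P] tdist_sym by auto
  have 0: "tdist (P i) z' = Suc (tdist (P j) z')"
    using i'[of i] i'[of j] j(2) sym by simp
  \<comment> \<open>The second conjunct carries the induction: \<open>farther_neighbor\<close>
    concludes that a step moves away from \<open>z'\<close> only if the preceding one did.\<close>
  have "k \<le> s \<Longrightarrow> int (tdist (f k) z') = int s' + \<bar>i - i'\<bar> + int k \<and>
      (k < s \<longrightarrow> tdist (f (Suc k)) z' = Suc (tdist (f k) z'))" for k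
  proof (induction k)
    case 0
    have "tdist (f 1) z' = Suc (tdist (P i) z')" if "0 < s"
    proof (rule farther_neighbor[OF j(1) _ z' _ \<open>tdist (P i) z' = _\<close>])
      show "{P i, f 1} \<in> E" using f(3)[of 0] f(1) that by simp
      have "tdist (P j) z = s + 1" using i[of j] j(3) sym(2) by simp
      then show "P j \<noteq> f 1" using f(4)[of 1] that by auto
    qed
    then show ?case using i'[of i] sym(1) f(1) by simp
  next
    case (Suc k)
    then have IH: "int (tdist (f k) z') = int s' + \<bar>i - i'\<bar> + int k"
      "tdist (f (Suc k)) z' = Suc (tdist (f k) z')" by auto
    have "tdist (f (Suc (Suc k))) z' = Suc (tdist (f (Suc k)) z')" if "Suc k < s"
    proof (rule farther_neighbor[OF _ _ z' _ IH(2)])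
      show "{f (Suc k), f k} \<in> E" using f(3)[of k] that by (simp add: insert_commute)
      show "{f (Suc k), f (Suc (Suc k))} \<in> E" using f(3)[of "Suc k"] that by simp
      show "f k \<noteq> f (Suc (Suc k))" using f(4)[of k] f(4)[of "Suc (Suc k)"] that by force
    qed
    with IH show ?case by simp
  qed
  from this[of s] show ?thesis using f(2) by simp
qed

end

section \<open>Elements of infinite order\<close>

definition infinite_order :: "('a, 'b) monoid_scheme \<Rightarrow> 'a \<Rightarrow> bool" where
  "infinite_order G a \<longleftrightarrow> a \<in> carrier G \<and> (\<forall>i::int. a [^]\<^bsub>G\<^esub> i = \<one>\<^bsub>G\<^esub> \<longrightarrow> i = 0)"

definition commensurable :: "('a, 'b) monoid_scheme \<Rightarrow> 'a \<Rightarrow> 'a \<Rightarrow> bool" where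
  "commensurable G a b \<longleftrightarrow>
     (\<exists>(m::int) (n::int). m \<noteq> 0 \<and> n \<noteq> 0 \<and> a [^]\<^bsub>G\<^esub> m = b [^]\<^bsub>G\<^esub> n)"

context group
begin

lemma infinite_order_closed: "infinite_order G a \<Longrightarrow> a \<in> carrier G"
  by (simp add: infinite_order_def)

lemma infinite_order_pow_eq:
  assumes "infinite_order G a"
  shows "a [^] (i::int) = a [^] (j::int) \<longleftrightarrow> i = j"
proof
  assume "a [^] i = a [^] j"
  then have "a [^] (i - j) = \<one>" using assms by (simp add: infinite_order_def int_pow_diff)
  then show "i = j" using assms unfolding infinite_order_def by force
qed simp

lemma infinite_order_pow: "\<lbrakk>infinite_order G a; n \<noteq> 0\<rbrakk> \<Longrightarrow> infinite_order G (a [^] (n::int))"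
  by (auto simp: infinite_order_def int_pow_pow)

lemma pow_int_subgroup:
  assumes "subgroup H G" "a \<in> H"
  shows "a [^] (i::int) \<in> H"
  by (rule subgroup_int_pow_closed[OF assms])

lemma infinite_cyclic_generator:
  assumes "infinite_cyclic_subgroup H G"
  obtains a where "infinite_order G a" "H = range (\<lambda>i::int. a [^] i)"
proof -
  have H: "subgroup H G" using assms by (simp add: infinite_cyclic_subgroup_def)
  interpret H: group "G\<lparr>carrier := H\<rparr>" using subgroup_imp_group[OF H] .
  have "integer_group \<cong> G\<lparr>carrier := H\<rparr>"
    by (rule H.iso_sym) (use assms in \<open>simp add: infinite_cyclic_subgroup_def\<close>)
  then obtain f where f: "f \<in> iso integer_group (G\<lparr>carrier := H\<rparr>)" by (auto simp: is_iso_def)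
  define a where "a = f 1"
  have fH: "f \<in> hom integer_group (G\<lparr>carrier := H\<rparr>)" "bij_betw f UNIV H"
    using f by (auto simp: iso_def)
  have aH: "a \<in> H" using fH(2) unfolding a_def bij_betw_def by blast
  have "f i = a [^] i" for i
  proof -
    have "f (1 [^]\<^bsub>integer_group\<^esub> i) = f 1 [^]\<^bsub>G\<lparr>carrier := H\<rparr>\<^esub> i"
      by (rule hom_int_pow[OF fH(1) _ group_integer_group H.is_group]) simp
    also have "\<dots> = a [^] i" unfolding a_def[symmetric] by (rule int_pow_consistent[OF H aH, symmetric])
    finally show ?thesis by simp
  qed
  then have f_eq: "f = (\<lambda>i. a [^] i)" by blast
  have a: "a \<in> carrier G" using aH subgroup.subset[OF H] by blast
  have "infinite_order G a"
    unfolding infinite_order_def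
  proof (intro conjI a allI impI)
    fix i :: int assume "a [^] i = \<one>"
    then have "f i = f 0" by (simp add: f_eq)
    then show "i = 0" using fH(2) by (auto simp: bij_betw_def inj_on_def)
  qed
  moreover have "H = range (\<lambda>i::int. a [^] i)" using fH(2) by (simp add: f_eq bij_betw_def)
  ultimately show thesis using that by blast
qed

lemma range_pow_subgroup: "a \<in> carrier G \<Longrightarrow> subgroup (range (\<lambda>i::int. a [^] i)) G"
  by (intro subgroupI)
    (auto simp: int_pow_mult[symmetric] int_pow_neg[symmetric])

lemma infinite_cyclicI:
  assumes a: "infinite_order G a"
  shows "infinite_cyclic_subgroup (range (\<lambda>i::int. a [^] i)) G"
proof -
  let ?H = "range (\<lambda>i::int. a [^] i)"
  have ac: "a \<in> carrier G" using a by (rule infinite_order_closed)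
  have H: "subgroup ?H G" by (rule range_pow_subgroup[OF ac])
  have "(\<lambda>i::int. a [^] i) \<in> iso integer_group (G\<lparr>carrier := ?H\<rparr>)"
  proof (rule isoI)
    show "(\<lambda>i::int. a [^] i) \<in> hom integer_group (G\<lparr>carrier := ?H\<rparr>)"
      using ac by (intro homI) (auto simp: int_pow_mult)
    show "bij_betw (\<lambda>i::int. a [^] i) (carrier integer_group) (carrier (G\<lparr>carrier := ?H\<rparr>))"
      using infinite_order_pow_eq[OF a] by (auto simp: bij_betw_def inj_on_def)
  qed
  then have "integer_group \<cong> G\<lparr>carrier := ?H\<rparr>" by (auto simp: is_iso_def)
  then have "G\<lparr>carrier := ?H\<rparr> \<cong> integer_group" by (rule group.iso_sym[OF group_integer_group])
  with H show ?thesis by (simp add: infinite_cyclic_subgroup_def)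
qed

text \<open>The exponents of the powers lying in \<open>H\<close> form a non-zero ideal of the
  integers, and \<open>n\<close> is its least positive element.\<close>

lemma exponents_of_subgroup:
  assumes a: "a \<in> carrier G" and H: "subgroup H G"
    and k: "a [^] (k::int) \<in> H" "k \<noteq> 0"
  obtains n :: nat where "0 < n" "\<And>k::int. a [^] k \<in> H \<longleftrightarrow> int n dvd k"
proof -
  define n where "n = (LEAST n::nat. 0 < n \<and> a [^] int n \<in> H)"
  have "a [^] (- k) \<in> H" using a k(1) H by (simp add: int_pow_neg subgroup.m_inv_closed)
  then have "a [^] \<bar>k\<bar> \<in> H" using k(1) by (simp add: abs_if)
  then have "0 < nat \<bar>k\<bar> \<and> a [^] int (nat \<bar>k\<bar>) \<in> H" using k(2) by simp
  then have n: "0 < n \<and> a [^] int n \<in> H" unfolding n_def by (rule LeastI)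
  have mult: "a [^] (int n * l) \<in> H" for l
    using pow_int_subgroup[OF H, of "a [^] int n" l] n a by (simp add: int_pow_pow)
  have "a [^] k \<in> H \<longleftrightarrow> int n dvd k" for k :: int
  proof
    assume k: "a [^] k \<in> H"
    have "k mod int n = k - int n * (k div int n)" by (simp add: minus_mult_div_eq_mod)
    then have "a [^] (k mod int n) = a [^] k \<otimes> inv (a [^] (int n * (k div int n)))"
      using a int_pow_diff by simp
    then have "a [^] (k mod int n) \<in> H"
      using k mult H subgroup.m_closed subgroup.m_inv_closed by metis
    moreover have "0 \<le> k mod int n" "k mod int n < int n" using n by auto
    ultimately have "\<not> 0 < nat (k mod int n)"
      using not_less_Least[of "nat (k mod int n)" "\<lambda>n. 0 < n \<and> a [^] int n \<in> H"] n_def by auto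
    then show "int n dvd k" using \<open>0 \<le> k mod int n\<close> by auto
  next
    assume "int n dvd k"
    then show "a [^] k \<in> H" using mult by (auto elim: dvdE)
  qed
  with n that show thesis by blast
qed

lemma infinite_cyclic_subgroup_of_cyclic:
  assumes a: "infinite_order G a" and H: "subgroup H G" "H \<subseteq> range (\<lambda>i::int. a [^] i)"
    and ne: "H \<noteq> {\<one>}"
  shows "infinite_cyclic_subgroup H G"
proof -
  have ac: "a \<in> carrier G" using a by (rule infinite_order_closed)
  have "\<one> \<in> H" using H(1) by (rule subgroup.one_closed)
  then obtain h where h: "h \<in> H" "h \<noteq> \<one>" using ne by blast
  then obtain k :: int where k: "h = a [^] k" using H(2) by blast
  then have "k \<noteq> 0" "a [^] k \<in> H" using h by auto
  then obtain n :: nat where n: "0 < n" "\<And>k::int. a [^] k \<in> H \<longleftrightarrow> int n dvd k"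
    using exponents_of_subgroup[OF ac H(1), of k] by blast
  have eq: "H = range (\<lambda>i::int. (a [^] int n) [^] i)"
  proof (intro equalityI subsetI)
    fix x assume x: "x \<in> H"
    then obtain k :: int where k: "x = a [^] k" using H(2) by blast
    then obtain l where "k = int n * l" using x n(2) by (auto elim: dvdE)
    then show "x \<in> range (\<lambda>i::int. (a [^] int n) [^] i)" using k ac by (auto simp: int_pow_pow)
  next
    fix x assume "x \<in> range (\<lambda>i::int. (a [^] int n) [^] i)"
    then obtain i :: int where "x = a [^] (int n * i)" using ac by (auto simp: int_pow_pow)
    then show "x \<in> H" using n(2)[of "int n * i"] by simp
  qed
  have "infinite_order G (a [^] int n)" by (rule infinite_order_pow[OF a]) (use n(1) in simp)
  then show ?thesis unfolding eq by (rule infinite_cyclicI)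
qed

lemma mult_inv_cancel [simp]:
  "\<lbrakk>g \<in> carrier G; y \<in> carrier G\<rbrakk> \<Longrightarrow> g \<otimes> (inv g \<otimes> y) = y"
  "\<lbrakk>g \<in> carrier G; y \<in> carrier G\<rbrakk> \<Longrightarrow> inv g \<otimes> (g \<otimes> y) = y"
  by (simp_all flip: m_assoc)

lemma conj_pow:
  assumes "g \<in> carrier G" "a \<in> carrier G"
  shows "(inv g \<otimes> a \<otimes> g) [^] (k::int) = inv g \<otimes> a [^] k \<otimes> g"
proof -
  have "(\<lambda>a. inv g \<otimes> a \<otimes> g) \<in> hom G G"
    using assms(1) by (intro homI) (simp_all add: m_assoc)
  from hom_int_pow[OF this assms(2) is_group is_group] show ?thesis by simp
qed

lemma commensurable_trans:
  assumes "a \<in> carrier G" "b \<in> carrier G" "c \<in> carrier G"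
    and "commensurable G a b" "commensurable G b c"
  shows "commensurable G a c"
proof -
  obtain m n :: int where 1: "m \<noteq> 0" "n \<noteq> 0" "a [^] m = b [^] n"
    using assms(4) unfolding commensurable_def by blast
  obtain m' n' :: int where 2: "m' \<noteq> 0" "n' \<noteq> 0" "b [^] m' = c [^] n'"
    using assms(5) unfolding commensurable_def by blast
  have "a [^] (m * m') = (a [^] m) [^] m'" using assms by (simp add: int_pow_pow)
  also have "\<dots> = (b [^] m') [^] n" using assms 1 by (simp add: int_pow_pow mult.commute)
  also have "\<dots> = c [^] (n' * n)" using assms 2 by (simp add: int_pow_pow)
  finally show ?thesis unfolding commensurable_def using 1 2 by (metis mult_eq_0_iff)
qed

text \<open>By the pigeonhole principle two powers of \<open>g\<close> lie in one coset, and their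
  quotient lies in \<open>H\<close>.\<close>

lemma finite_index_pow:
  assumes H: "subgroup H G" "finite (rcosets H)" and g: "g \<in> carrier G"
  obtains j :: nat where "0 < j" "g [^] j \<in> H"
proof -
  have "range (\<lambda>j::nat. H #> g [^] j) \<subseteq> rcosets H" using g by (auto simp: RCOSETS_def)
  then have "\<not> inj (\<lambda>j::nat. H #> g [^] j)"
    using H(2) finite_subset finite_imageD infinite_UNIV_nat by metis
  then obtain i j :: nat where ij: "i \<noteq> j" "H #> g [^] i = H #> g [^] j" by (auto simp: inj_def)
  have "\<exists>k>0. g [^] (k::nat) \<in> H" if "i < j" "H #> g [^] i = H #> g [^] j" for i j :: nat
  proof -
    have "g [^] j \<in> H #> g [^] i" using that(2) H(1) g by (simp add: rcos_self)
    then obtain h where h: "h \<in> H" "g [^] j = h \<otimes> g [^] i" by (auto simp: r_coset_def)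
    have "g [^] (j - i) \<otimes> g [^] i = h \<otimes> g [^] i"
      using that(1) g h(2) by (simp add: nat_pow_mult)
    then have "g [^] (j - i) = h" using g h(1) subgroup.mem_carrier[OF H(1)] by simp
    with h(1) that(1) show ?thesis by (intro exI[of _ "j - i"]) auto
  qed
  from this[of i j] this[of j i] ij show thesis using that by (metis linorder_neqE_nat)
qed

section \<open>Recognizing the free abelian group of rank 2 and the Klein bottle group\<close>

lemma iso_from_normal_form:
  assumes K: "group K" and car: "carrier K = (UNIV :: (int \<times> int) set)"
    and xy: "x \<in> carrier G" "y \<in> carrier G"
    and surj: "\<And>c. c \<in> carrier G \<Longrightarrow> \<exists>(n::int) (m::int). c = y [^] n \<otimes> x [^] m"
    and triv: "\<And>(n::int) (m::int). y [^] n \<otimes> x [^] m = \<one> \<Longrightarrow> n = 0 \<and> m = 0"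
    and hom: "(\<lambda>(n::int, m::int). y [^] n \<otimes> x [^] m) \<in> hom K G" and one: "\<one>\<^bsub>K\<^esub> = (0, 0)"
  shows "G \<cong> K"
proof -
  interpret f: group_hom K G "\<lambda>(n::int, m::int). y [^] n \<otimes> x [^] m"
    using K hom by (simp add: group_hom_def group_hom_axioms_def is_group)
  have "(\<lambda>(n::int, m::int). y [^] n \<otimes> x [^] m) \<in> iso K G"
    unfolding Group.iso_iff
  proof (intro conjI hom)
    show "(\<lambda>(n::int, m::int). y [^] n \<otimes> x [^] m) ` carrier K = carrier G"
    proof
      show "carrier G \<subseteq> (\<lambda>(n::int, m::int). y [^] n \<otimes> x [^] m) ` carrier K"
        using surj unfolding car by (force intro: rev_image_eqI)
    qed (use xy in auto)
    show "inj_on (\<lambda>(n::int, m::int). y [^] n \<otimes> x [^] m) (carrier K)"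
      unfolding f.inj_on_one_iff using triv one by (auto split: prod.splits)
  qed
  then show ?thesis using group.iso_sym[OF K] by (auto simp: is_iso_def)
qed

text \<open>Here \<open>y\<close> and \<open>x\<close> are the b and a of the presentation. Moving a
  power of \<open>x\<close> to the right past a power of \<open>y\<close> inverts the latter when
  the exponent of \<open>x\<close> is odd, which is the twist in the multiplication of
  \<open>klein_bottle_group\<close>.\<close>

lemma iso_klein_bottle:
  assumes xy: "x \<in> carrier G" "y \<in> carrier G"
    and surj: "\<And>c. c \<in> carrier G \<Longrightarrow> \<exists>(n::int) (m::int). c = y [^] n \<otimes> x [^] m"
    and triv: "\<And>(n::int) (m::int). y [^] n \<otimes> x [^] m = \<one> \<Longrightarrow> n = 0 \<and> m = 0"
    and rel: "x \<otimes> y \<otimes> inv x = inv y"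
  shows "G \<cong> klein_bottle_group"
proof (rule iso_from_normal_form[OF group_klein_bottle_group _ xy surj triv])
  have 1: "x \<otimes> y [^] n = y [^] (- n) \<otimes> x" for n :: int
  proof -
    have "x \<otimes> y [^] n \<otimes> inv x = (x \<otimes> y \<otimes> inv x) [^] n"
      using conj_pow[of "inv x" y n] xy by simp
    then have "x \<otimes> y [^] n \<otimes> inv x = y [^] (- n)" using xy by (simp add: rel int_pow_inv int_pow_neg)
    then show ?thesis using xy by (metis inv_solve_right int_pow_closed m_closed)
  qed
  have 2: "inv x \<otimes> y [^] n = y [^] (- n) \<otimes> inv x" for n :: int
  proof -
    have "x \<otimes> (y [^] (- n) \<otimes> inv x) = (x \<otimes> y [^] (- n)) \<otimes> inv x" using xy by (simp add: m_assoc)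
    also have "\<dots> = y [^] n" unfolding 1 using xy by (simp add: m_assoc)
    finally show ?thesis using xy by (metis inv_closed mult_inv_cancel(2) int_pow_closed m_closed)
  qed
  \<comment> \<open>\<open>n\<close> stays arbitrary because each step, in either direction, uses
    the hypothesis at \<open>- n\<close>.\<close>
  have comm: "x [^] m \<otimes> y [^] n = y [^] (if even m then n else - n) \<otimes> x [^] m" for m n :: int
  proof (induction m arbitrary: n rule: int_induct[of _ 0])
    case base
    then show ?case using xy by simp
  next
    case (step1 i)
    have "x [^] (i + 1) \<otimes> y [^] n = x [^] i \<otimes> (x \<otimes> y [^] n)"
      using xy by (simp add: int_pow_mult m_assoc)
    also have "\<dots> = (x [^] i \<otimes> y [^] (- n)) \<otimes> x" unfolding 1 using xy by (simp add: m_assoc)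
    also have "\<dots> = y [^] (if even i then - n else n) \<otimes> (x [^] i \<otimes> x)"
      unfolding step1 using xy by (simp add: m_assoc)
    finally show ?case using xy by (simp add: int_pow_mult)
  next
    case (step2 i)
    have "x [^] (i - 1) \<otimes> y [^] n = x [^] i \<otimes> (inv x \<otimes> y [^] n)"
      using xy by (simp add: int_pow_diff m_assoc)
    also have "\<dots> = (x [^] i \<otimes> y [^] (- n)) \<otimes> inv x" unfolding 2 using xy by (simp add: m_assoc)
    also have "\<dots> = y [^] (if even i then - n else n) \<otimes> (x [^] i \<otimes> inv x)"
      unfolding step2 using xy by (simp add: m_assoc)
    finally show ?case using xy by (simp add: int_pow_diff)
  qed
  show "(\<lambda>(n::int, m::int). y [^] n \<otimes> x [^] m) \<in> hom klein_bottle_group G"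
  proof (rule homI)
    fix p q assume "p \<in> carrier klein_bottle_group" "q \<in> carrier klein_bottle_group"
    obtain n m n' m' where pq: "p = (n, m)" "q = (n', m')" by (cases p, cases q)
    have "(y [^] n \<otimes> x [^] m) \<otimes> (y [^] n' \<otimes> x [^] m') = y [^] n \<otimes> (x [^] m \<otimes> y [^] n') \<otimes> x [^] m'"
      using xy by (simp add: m_assoc)
    also have "\<dots> = y [^] (n + (if even m then n' else - n')) \<otimes> x [^] (m + m')"
      unfolding comm int_pow_mult[OF xy(1)] int_pow_mult[OF xy(2)] using xy by (simp add: m_assoc)
    finally show "(case p \<otimes>\<^bsub>klein_bottle_group\<^esub> q of (n::int, m::int) \<Rightarrow> y [^] n \<otimes> x [^] m) =
        (case p of (n::int, m::int) \<Rightarrow> y [^] n \<otimes> x [^] m) \<otimes> (case q of (n::int, m::int) \<Rightarrow> y [^] n \<otimes> x [^] m)"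
      by (simp add: pq klein_bottle_group_def)
  qed (use xy in auto)
qed (auto simp: klein_bottle_group_def)

lemma iso_free_abelian_2:
  assumes xy: "x \<in> carrier G" "y \<in> carrier G"
    and surj: "\<And>c. c \<in> carrier G \<Longrightarrow> \<exists>(n::int) (m::int). c = y [^] n \<otimes> x [^] m"
    and triv: "\<And>(n::int) (m::int). y [^] n \<otimes> x [^] m = \<one> \<Longrightarrow> n = 0 \<and> m = 0"
    and rel: "x \<otimes> y \<otimes> inv x = y"
  shows "G \<cong> integer_group \<times>\<times> integer_group"
proof (rule iso_from_normal_form[OF _ _ xy surj triv])
  have "x \<otimes> y [^] n \<otimes> inv x = y [^] n" for n :: int
    using conj_pow[of "inv x" y n] xy by (simp add: rel)
  then have "y [^] n \<otimes> x \<otimes> inv (y [^] n) = x" for n :: int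
    using xy by (metis inv_solve_right int_pow_closed m_closed)
  then have "y [^] n \<otimes> x [^] m \<otimes> inv (y [^] n) = x [^] m" for n m :: int
    using conj_pow[of "inv (y [^] n)" x m] xy by simp
  then have comm: "x [^] m \<otimes> y [^] n = y [^] n \<otimes> x [^] m" for n m :: int
    using xy by (metis inv_solve_right int_pow_closed m_closed)
  show "(\<lambda>(n::int, m::int). y [^] n \<otimes> x [^] m) \<in> hom (integer_group \<times>\<times> integer_group) G"
  proof (rule homI)
    fix p q :: "int \<times> int"
    obtain n m n' m' where pq: "p = (n, m)" "q = (n', m')" by (cases p, cases q)
    have "(y [^] n \<otimes> x [^] m) \<otimes> (y [^] n' \<otimes> x [^] m') = y [^] n \<otimes> (x [^] m \<otimes> y [^] n') \<otimes> x [^] m'"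
      using xy by (simp add: m_assoc)
    also have "\<dots> = y [^] (n + n') \<otimes> x [^] (m + m')"
      unfolding comm int_pow_mult[OF xy(1)] int_pow_mult[OF xy(2)] using xy by (simp add: m_assoc)
    finally show "(case p \<otimes>\<^bsub>integer_group \<times>\<times> integer_group\<^esub> q of (n::int, m::int) \<Rightarrow> y [^] n \<otimes> x [^] m) =
        (case p of (n::int, m::int) \<Rightarrow> y [^] n \<otimes> x [^] m) \<otimes> (case q of (n::int, m::int) \<Rightarrow> y [^] n \<otimes> x [^] m)"
      by (simp add: pq mult_DirProd)
  qed (use xy in auto)
qed (auto simp: DirProd_group one_DirProd)

end

section \<open>GBS trees and axes\<close>

sublocale gbs_tree \<subseteq> group G
  by (rule is_group_G)

context gbs_tree
begin

lemma act_mult: "\<lbrakk>g \<in> carrier G; h \<in> carrier G; x \<in> X\<rbrakk> \<Longrightarrow> \<phi> (g \<otimes> h) x = \<phi> g (\<phi> h x)"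
  by (rule composition_rule)

lemma act_inv:
  assumes "g \<in> carrier G" "x \<in> X"
  shows "\<phi> (inv g) (\<phi> g x) = x" "\<phi> g (\<phi> (inv g) x) = x"
  using assms act_mult[of "inv g" g x] act_mult[of g "inv g" x] by (auto simp: phi_one)

lemma act_eq_iff: "\<lbrakk>g \<in> carrier G; x \<in> X; y \<in> X\<rbrakk> \<Longrightarrow> \<phi> g x = \<phi> g y \<longleftrightarrow> x = y"
  using act_inv(1) by metis

lemma act_edge: "\<lbrakk>g \<in> carrier G; {u, v} \<in> E\<rbrakk> \<Longrightarrow> {\<phi> g u, \<phi> g v} \<in> E"
  using edge_image[of g "{u, v}"] by simp

lemma act_tdist:
  assumes g: "g \<in> carrier G" and uv: "u \<in> X" "v \<in> X"
  shows "tdist (\<phi> g u) (\<phi> g v) = tdist u v"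
proof -
  have le: "tdist (\<phi> g u) (\<phi> g v) \<le> tdist u v"
    if guv: "g \<in> carrier G" "u \<in> X" "v \<in> X" for g u v
  proof (rule tdist_le)
    obtain f where f: "f 0 = u" "f (tdist u v) = v" "\<forall>i<tdist u v. (f i, f (Suc i)) \<in> adjacency E"
      using tdist_walk[OF guv(2,3)] unfolding relpow_fun_conv by blast
    then show "(\<phi> g u, \<phi> g v) \<in> adjacency E ^^ tdist u v"
      unfolding relpow_fun_conv using act_edge[OF guv(1)]
      by (intro exI[of _ "\<lambda>i. \<phi> g (f i)"]) (auto simp: adjacency_def)
  qed
  from le[OF g uv] le[of "inv g" "\<phi> g u" "\<phi> g v"] show ?thesis
    using g uv by (simp add: act_inv phi_in)
qed

lemma stab_iff: "g \<in> stabilizer G \<phi> x \<longleftrightarrow> g \<in> carrier G \<and> \<phi> g x = x"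
  by (simp add: stabilizer_def)

lemma act_int_pow_fix:
  assumes "g \<in> carrier G" "x \<in> X" "\<phi> g x = x"
  shows "\<phi> (g [^] (i::int)) x = x"
  using pow_int_subgroup[OF stabilizer_subgroup[OF assms(2)], of g i] assms by (simp add: stab_iff)

lemma stab_generator:
  assumes "x \<in> X"
  obtains w where "infinite_order G w" "stabilizer G \<phi> x = range (\<lambda>i::int. w [^] i)"
  using infinite_cyclic_generator[OF vertex_stabilizer[OF assms]] .

lemma elliptic_infinite_order:
  assumes "x \<in> X" "a \<in> stabilizer G \<phi> x" "a \<noteq> \<one>"
  shows "infinite_order G a"
proof -
  obtain w where w: "infinite_order G w" "stabilizer G \<phi> x = range (\<lambda>i::int. w [^] i)"
    using stab_generator[OF assms(1)] .
  then obtain i :: int where "a = w [^] i" using assms(2) by blast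
  then show ?thesis using infinite_order_pow[OF w(1), of i] assms(3) by (cases "i = 0") auto
qed

section \<open>Translations along a line, displacement and axes\<close>

definition translates :: "'a \<Rightarrow> (int \<Rightarrow> 'v) \<Rightarrow> int \<Rightarrow> bool" where
  "translates g P t \<longleftrightarrow> (\<forall>i. \<phi> g (P i) = P (i + t))"

lemma translates_mult:
  assumes "line P" "g \<in> carrier G" "h \<in> carrier G" "translates g P s" "translates h P t"
  shows "translates (g \<otimes> h) P (s + t)"
  using assms line_in[OF assms(1)] unfolding translates_def by (simp add: act_mult algebra_simps)

lemma translates_inv:
  assumes "line P" "g \<in> carrier G" "translates g P t"
  shows "translates (inv g) P (- t)"
  unfolding translates_def
proof
  fix i
  have "\<phi> g (P (i - t)) = P i" using assms(3) by (simp add: translates_def)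
  then show "\<phi> (inv g) (P i) = P (i + - t)"
    using act_inv(1)[OF assms(2) line_in[OF assms(1), of "i - t"]] by simp
qed

lemma translates_pow:
  assumes P: "line P" and g: "g \<in> carrier G" "translates g P t"
  shows "translates (g [^] (k::int)) P (k * t)"
proof (induction k rule: int_induct[of _ 0])
  case base
  then show ?case using line_in[OF P] by (simp add: translates_def phi_one)
next
  case (step1 i)
  then show ?case
    using translates_mult[OF P _ g(1) step1(2) g(2)] g(1) by (simp add: int_pow_mult distrib_right)
next
  case (step2 i)
  then show ?case
    using translates_mult[OF P _ _ step2(2) translates_inv[OF P g]] g(1)
    by (simp add: int_pow_diff left_diff_distrib)
qed

text \<open>\<open>s\<close> is the distance from \<open>z\<close> to the line. The projection of
  \<open>\<phi> h z\<close> is that of \<open>z\<close> shifted by \<open>t\<close>, so the two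
  projections differ and \<open>tdist_across_line\<close> applies. One \<open>s\<close> serves all
  \<open>h\<close>, which lets an element be compared with its square.\<close>

lemma displacement:
  assumes P: "line P" and z: "z \<in> X"
  obtains s :: nat where "s = 0 \<longleftrightarrow> z \<in> range P"
    "\<And>h t. \<lbrakk>h \<in> carrier G; translates h P t; t \<noteq> 0\<rbrakk> \<Longrightarrow>
       int (tdist z (\<phi> h z)) = 2 * int s + \<bar>t\<bar>"
proof -
  note goal = that
  obtain i s where i: "\<And>j. int (tdist z (P j)) = int s + \<bar>j - i\<bar>" "tdist z (P i) = s"
    using line_projection[OF P z] by blast
  have "s = 0 \<longleftrightarrow> z \<in> range P"
  proof
    assume "s = 0"
    then show "z \<in> range P" using i(2) z line_in[OF P] tdist_eq_0 by blast
  next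
    assume "z \<in> range P"
    then obtain j where "z = P j" by blast
    then show "s = 0" using i(1)[of j] by simp
  qed
  moreover have "int (tdist z (\<phi> h z)) = 2 * int s + \<bar>t\<bar>"
    if h: "h \<in> carrier G" "translates h P t" "t \<noteq> 0" for h t
  proof -
    have "int (tdist (\<phi> h z) (P j)) = int s + \<bar>j - (i + t)\<bar>" for j
    proof -
      have "P j = \<phi> h (P (j - t))" using h(2) by (simp add: translates_def)
      then have "tdist (\<phi> h z) (P j) = tdist z (P (j - t))"
        using act_tdist[OF h(1) z line_in[OF P]] by simp
      then show ?thesis using i(1)[of "j - t"] by (simp add: algebra_simps)
    qed
    from tdist_across_line[OF P z phi_in[OF h(1) z] i(1) this] h(3) show ?thesis by simp
  qed
  ultimately show thesis by (rule goal)
qed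

lemma translation_no_fixed_vertex:
  assumes "line P" "h \<in> carrier G" "translates h P t" "t \<noteq> 0" "z \<in> X"
  shows "\<phi> h z \<noteq> z"
proof
  assume "\<phi> h z = z"
  moreover obtain s :: nat where "int (tdist z (\<phi> h z)) = 2 * int s + \<bar>t\<bar>"
    using displacement[OF assms(1,5)] assms(2-4) by metis
  ultimately show False using assms(4) by simp
qed

text \<open>If \<open>h\<close> translates a line by a non-zero \<open>t\<close>, then
  \<open>h\<close> moves a vertex at distance \<open>s\<close> from the line by
  \<open>2s + |t|\<close> and \<open>h \<otimes> h\<close> moves it by \<open>2s + 2|t|\<close>, so
  the equation says \<open>s = 0\<close>. As no line is mentioned, the set is carried along by
  conjugation.\<close>

definition axis :: "'a \<Rightarrow> 'v set" where
  "axis h = {z \<in> X. tdist z (\<phi> (h \<otimes> h) z) = 2 * tdist z (\<phi> h z)}"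

lemma axis_translation:
  assumes "line P" "h \<in> carrier G" "translates h P t" "t \<noteq> 0"
  shows "axis h = range P"
proof -
  have "z \<in> axis h \<longleftrightarrow> z \<in> range P" if z: "z \<in> X" for z
  proof -
    obtain s :: nat where s: "s = 0 \<longleftrightarrow> z \<in> range P"
      "\<And>h t. \<lbrakk>h \<in> carrier G; translates h P t; t \<noteq> 0\<rbrakk> \<Longrightarrow>
         int (tdist z (\<phi> h z)) = 2 * int s + \<bar>t\<bar>"
      using displacement[OF assms(1) z] by blast
    have "int (tdist z (\<phi> h z)) = 2 * int s + \<bar>t\<bar>" using s(2)[OF assms(2-4)] .
    moreover have "int (tdist z (\<phi> (h \<otimes> h) z)) = 2 * int s + \<bar>t + t\<bar>"
      using s(2)[OF _ translates_mult[OF assms(1,2,2,3,3)]] assms(2,4) by simp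
    ultimately show ?thesis unfolding axis_def s(1)[symmetric] using z by auto
  qed
  then show ?thesis using line_in[OF assms(1)] by (auto simp: axis_def)
qed

lemma axis_conj:
  assumes c: "c \<in> carrier G" and h: "h \<in> carrier G"
  shows "axis (c \<otimes> h \<otimes> inv c) = \<phi> c ` axis h"
proof -
  let ?h = "c \<otimes> h \<otimes> inv c"
  have *: "\<phi> c z \<in> axis ?h \<longleftrightarrow> z \<in> axis h" if z: "z \<in> X" for z
  proof -
    have 1: "\<phi> ?h (\<phi> c z) = \<phi> c (\<phi> h z)" using c h z by (simp add: act_mult act_inv phi_in)
    have 2: "\<phi> (?h \<otimes> ?h) (\<phi> c z) = \<phi> c (\<phi> (h \<otimes> h) z)"
      using c h z 1 by (simp add: act_mult[of ?h ?h] phi_in) (simp add: act_mult act_inv phi_in)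
    show ?thesis unfolding axis_def using 1 2 c h z by (simp add: act_tdist phi_in)
  qed
  show ?thesis
  proof (intro equalityI subsetI)
    fix z assume z: "z \<in> axis ?h"
    then have "z \<in> X" by (simp add: axis_def)
    then have "z = \<phi> c (\<phi> (inv c) z)" "\<phi> (inv c) z \<in> X" using c by (simp_all add: act_inv phi_in)
    with z * show "z \<in> \<phi> c ` axis h" by (metis image_eqI)
  next
    fix z assume "z \<in> \<phi> c ` axis h"
    then obtain y where "y \<in> axis h" "z = \<phi> c y" by blast
    with * show "z \<in> axis ?h" by (simp add: axis_def)
  qed
qed

text \<open>The geodesic from \<open>y\<close> to \<open>\<phi> g y\<close> starts with the edge to
  \<open>y1\<close> and ends with the image of that edge, so cutting off both gives a shorter path
  from \<open>y1\<close> to its image. If it were a single edge, \<open>g\<close> would invert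
  it.\<close>

lemma backtracking_shortens:
  assumes g: "g \<in> carrier G" and y: "{y, y1} \<in> E"
    and closer: "tdist y (\<phi> g y) = Suc (tdist y1 (\<phi> g y))"
    and backtrack: "tdist (\<phi> g y) y = Suc (tdist (\<phi> g y1) y)"
  shows "tdist y1 (\<phi> g y1) < tdist y (\<phi> g y)"
proof -
  have X: "y \<in> X" "y1 \<in> X" "\<phi> g y \<in> X" "\<phi> g y1 \<in> X" using edge_in[OF y] phi_in g by auto
  have e: "{\<phi> g y, \<phi> g y1} \<in> E" using act_edge[OF g y] .
  show ?thesis
  proof (cases "\<phi> g y = y1")
    case True
    then have "tdist y (\<phi> g y) = 1" using closer by simp
    then have "tdist (\<phi> g y1) y = 0" using backtrack tdist_sym[OF X(1,3)] by simp
    then have "\<phi> g y1 = y" using X tdist_eq_0 by blast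
    with True no_inversion[OF g y] show ?thesis by simp
  next
    case False
    \<comment> \<open>\<open>z\<close> is the last vertex before \<open>\<phi> g y\<close> on the
      way from \<open>y1\<close>. It also brings \<open>\<phi> g y\<close> closer to
      \<open>y\<close>, and so it must be \<open>\<phi> g y1\<close>.\<close>
    obtain z where z: "{\<phi> g y, z} \<in> E" "tdist (\<phi> g y) y1 = Suc (tdist z y1)"
      using closer_neighbor[OF X(3,2) False] .
    have zX: "z \<in> X" using edge_in[OF z(1)] by simp
    have "tdist z y \<le> Suc (tdist z y1)"
      using tdist_edge_le[OF y zX] tdist_sym zX X by simp
    moreover have "tdist (\<phi> g y) y \<le> Suc (tdist z y)" using tdist_edge_le[OF z(1) X(1)] .
    ultimately have "tdist (\<phi> g y) y = Suc (tdist z y)"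
      using z(2) closer tdist_sym X by simp
    then have "z = \<phi> g y1" using closer_neighbor_unique[OF z(1) e X(1) _ backtrack] by simp
    then show ?thesis using z(2) closer tdist_sym X by simp
  qed
qed

text \<open>The images of the segment from \<open>y\<close> to \<open>\<phi> g y\<close> under the
  powers of \<open>g\<close> are placed end to end; \<open>nonback\<close> excludes backtracking at
  the joins.\<close>

lemma line_from_nonbacktracking:
  assumes g: "g \<in> carrier G" and y: "{y, y1} \<in> E"
    and closer: "tdist y (\<phi> g y) = Suc (tdist y1 (\<phi> g y))"
    and nonback: "tdist (\<phi> g y) y \<noteq> Suc (tdist (\<phi> g y1) y)"
  obtains P where "line P" "P 0 = y" "translates g P (int (tdist y (\<phi> g y)))"
proof -
  define n where "n = tdist y (\<phi> g y)"
  have n0: "0 < n" using closer by (simp add: n_def)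
  have X: "y \<in> X" "y1 \<in> X" "\<phi> g y \<in> X" "\<phi> g y1 \<in> X" using edge_in[OF y] phi_in g by auto
  obtain f where f: "f 0 = y" "f n = \<phi> g y" "\<And>i. i < n \<Longrightarrow> {f i, f (Suc i)} \<in> E"
    "\<And>i. i \<le> n \<Longrightarrow> f i \<in> X \<and> tdist (f i) (\<phi> g y) = n - i"
    using geodesic[OF X(1,3)] unfolding n_def by blast
  have f1: "f 1 = y1"
  proof (rule closer_neighbor_unique[OF _ y X(3) _ closer])
    show "{y, f 1} \<in> E" using f(3)[of 0] f(1) n0 by simp
    show "tdist y (\<phi> g y) = Suc (tdist (f 1) (\<phi> g y))" using f(4)[of 1] n0 n_def by simp
  qed
  define P where "P = (\<lambda>i::int. \<phi> (g [^] (i div int n)) (f (nat (i mod int n))))"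
  have shift: "\<phi> (g [^] (k + 1)) x = \<phi> (g [^] k) (\<phi> g x)" if "x \<in> X" for k :: int and x
    using g that by (simp add: int_pow_mult act_mult)
  \<comment> \<open>Allowing \<open>r = n\<close> makes the formula valid at a join for both
    segments meeting there.\<close>
  have Peq: "P (k * int n + int r) = \<phi> (g [^] k) (f r)" if "r \<le> n" for k :: int and r
  proof (cases "r = n")
    case True
    have "(k * int n + int n) div int n = k + 1" using n0 by (simp add: div_add1_eq)
    then have "P (k * int n + int r) = \<phi> (g [^] (k + 1)) y" using True f(1) by (simp add: P_def)
    then show ?thesis using True shift[OF X(1)] f(2) by simp
  next
    case False
    then have "(k * int n + int r) div int n = k" "(k * int n + int r) mod int n = int r"
      using that n0 by (simp_all add: div_add1_eq)
    then show ?thesis by (simp add: P_def)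
  qed
  have decomp: "\<exists>k r. i = k * int n + int r \<and> r < n" for i
    by (rule exI[of _ "i div int n"], rule exI[of _ "nat (i mod int n)"]) (use n0 in \<open>simp add: nat_less_iff\<close>)
  have "line P"
    unfolding line_def
  proof (intro allI conjI)
    fix i
    obtain k r where kr: "i = k * int n + int r" "r < n" using decomp by blast
    have 0: "P i = \<phi> (g [^] k) (f r)" using Peq[of r k] kr by simp
    have 1: "P (i + 1) = \<phi> (g [^] k) (f (Suc r))"
      using Peq[of "Suc r" k] kr by (simp add: algebra_simps)
    show "{P i, P (i + 1)} \<in> E" unfolding 0 1 using g f(3)[OF kr(2)] by (intro act_edge) auto
    show "P i \<noteq> P (i + 2)"
    proof (cases "Suc (Suc r) \<le> n")
      case True
      then have 2: "P (i + 2) = \<phi> (g [^] k) (f (Suc (Suc r)))"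
        using Peq[of "Suc (Suc r)" k] kr by (simp add: algebra_simps)
      have "tdist (f r) (\<phi> g y) \<noteq> tdist (f (Suc (Suc r))) (\<phi> g y)"
        using f(4)[of r] f(4)[of "Suc (Suc r)"] True by simp
      then have "f r \<noteq> f (Suc (Suc r))" by auto
      then show ?thesis unfolding 0 2 using g f(4)[of r] f(4)[of "Suc (Suc r)"] True
        by (simp add: act_eq_iff)
    next
      \<comment> \<open>Position \<open>i + 1\<close> is a join. Up to \<open>g [^] k\<close>, its
        neighbours on the line are the last inner vertex \<open>f r\<close> of the segment, which is
        nearer to \<open>y\<close>, and \<open>\<phi> g y1\<close>, which by \<open>nonback\<close>
        is not.\<close>
      case False
      then have r: "n = Suc r" using kr(2) by simp
      have i2: "i + 2 = (k + 1) * int n + int 1" using kr(1) r by (simp add: algebra_simps)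
      have "P (i + 2) = \<phi> (g [^] (k + 1)) (f 1)" unfolding i2 using n0 by (intro Peq) simp
      then have 2: "P (i + 2) = \<phi> (g [^] k) (\<phi> g y1)" using f1 shift[OF X(2)] by simp
      have "f 0 \<in> X" using f(1) X(1) by simp
      from tdist_along_walk[OF this f(3), of n r] f(4)[of r] f(1) r
      have fr: "f r \<in> X" "tdist y (f r) \<le> r" "tdist (f r) (\<phi> g y) = 1" by auto
      have "tdist y (\<phi> g y) \<le> tdist y (f r) + 1"
        using tdist_triangle[OF X(1) fr(1) X(3)] fr(3) by simp
      then have "tdist y (f r) = r" using fr(2) r n_def by simp
      then have "tdist (\<phi> g y) y = Suc (tdist (f r) y)" using r n_def tdist_sym X fr(1) by metis
      then have "f r \<noteq> \<phi> g y1" using nonback by auto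
      then show ?thesis unfolding 0 2 using g fr(1) X(4) by (simp add: act_eq_iff)
    qed
  qed
  moreover have "P 0 = y" using Peq[of 0 0] f(1) X(1) by (simp add: phi_one)
  moreover have "translates g P (int n)"
    unfolding translates_def
  proof
    fix i
    obtain k r where kr: "i = k * int n + int r" "r < n" using decomp by blast
    have fr: "f r \<in> X" using f(4)[of r] kr(2) by simp
    have "\<phi> g (P i) = \<phi> (g \<otimes> g [^] k) (f r)" using Peq[of r k] kr g fr by (simp add: act_mult)
    also have "g \<otimes> g [^] k = g [^] (k + 1)" using g by (metis add.commute int_pow_1 int_pow_mult)
    also have "\<phi> \<dots> (f r) = P (i + int n)" using Peq[of r "k + 1"] kr by (simp add: algebra_simps)
    finally show "\<phi> g (P i) = P (i + int n)" .
  qed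
  ultimately show thesis using that n_def by blast
qed

text \<open>At a vertex of least displacement the segment to its image cannot backtrack, since
  \<open>backtracking_shortens\<close> would yield a smaller displacement.\<close>

lemma axis_exists:
  assumes g: "g \<in> carrier G" and free: "\<And>x. x \<in> X \<Longrightarrow> \<phi> g x \<noteq> x"
  obtains P t where "line P" "translates g P t" "0 < t"
proof -
  define n where "n = (LEAST n. \<exists>y\<in>X. tdist y (\<phi> g y) = n)"
  have "\<exists>y\<in>X. tdist y (\<phi> g y) = n"
    unfolding n_def by (rule LeastI_ex) (use nonempty in blast)
  then obtain y where y: "y \<in> X" "tdist y (\<phi> g y) = n" by blast
  have min: "n \<le> tdist x (\<phi> g x)" if "x \<in> X" for x
    unfolding n_def using that by (intro Least_le) blast
  obtain y1 where y1: "{y, y1} \<in> E" "tdist y (\<phi> g y) = Suc (tdist y1 (\<phi> g y))"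
    using closer_neighbor[OF y(1) phi_in[OF g y(1)]] free[OF y(1)] by metis
  have "tdist (\<phi> g y) y \<noteq> Suc (tdist (\<phi> g y1) y)"
    using backtracking_shortens[OF g y1] min[of y1] edge_in[OF y1(1)] y(2) by auto
  then obtain P where "line P" "P 0 = y" "translates g P (int (tdist y (\<phi> g y)))"
    using line_from_nonbacktracking[OF g y1] by blast
  then show thesis using that y1(2) by simp
qed

lemma free_pow:
  assumes g: "g \<in> carrier G" and free: "\<And>x. x \<in> X \<Longrightarrow> \<phi> g x \<noteq> x"
    and k: "k \<noteq> 0" and x: "x \<in> X"
  shows "\<phi> (g [^] (k::int)) x \<noteq> x"
proof -
  obtain P t where P: "line P" "translates g P t" "0 < t" using axis_exists[OF g free] by blast
  show ?thesis
    using translation_no_fixed_vertex[OF P(1) _ translates_pow[OF P(1) g P(2)] _ x] g k P(3) by simp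
qed

text \<open>\<open>h\<close> preserves the distances to the two fixed ends, and these determine a
  vertex on the geodesic between them.\<close>

lemma fixes_between:
  assumes P: "line P" and h: "h \<in> carrier G" "\<phi> h (P i) = P i" "\<phi> h (P k) = P k"
    and j: "i \<le> j" "j \<le> k"
  shows "\<phi> h (P j) = P j"
proof (rule geodesic_point_unique)
  note X = line_in[OF P]
  have 1: "tdist (P i) (\<phi> h (P j)) = tdist (P i) (P j)" "tdist (\<phi> h (P j)) (P k) = tdist (P j) (P k)"
    using act_tdist[OF h(1) X[of i] X[of j]] act_tdist[OF h(1) X[of j] X[of k]] h by auto
  have 2: "tdist (P i) (P j) + tdist (P j) (P k) = tdist (P i) (P k)"
    using line_tdist[OF P, of i j] line_tdist[OF P, of j k] line_tdist[OF P, of i k] j by linarith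
  show "P i \<in> X" "P k \<in> X" "\<phi> h (P j) \<in> X" "P j \<in> X" using X phi_in h(1) by auto
  show "tdist (P i) (\<phi> h (P j)) + tdist (\<phi> h (P j)) (P k) = tdist (P i) (P k)"
    "tdist (P i) (P j) + tdist (P j) (P k) = tdist (P i) (P k)"
    "tdist (P i) (\<phi> h (P j)) = tdist (P i) (P j)" using 1 2 by auto
qed

section \<open>Commensurability of elliptic elements\<close>

lemma commensurable_same_vertex:
  assumes "x \<in> X" "a \<in> stabilizer G \<phi> x" "b \<in> stabilizer G \<phi> x" "a \<noteq> \<one>" "b \<noteq> \<one>"
  shows "commensurable G a b"
proof -
  obtain w where w: "infinite_order G w" "stabilizer G \<phi> x = range (\<lambda>i::int. w [^] i)"
    using stab_generator[OF assms(1)] .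
  obtain i j :: int where ij: "a = w [^] i" "b = w [^] j" using w(2) assms(2,3) by blast
  have "a [^] j = b [^] i" unfolding ij
    using infinite_order_closed[OF w(1)] by (simp add: int_pow_pow mult.commute)
  moreover have "i \<noteq> 0" "j \<noteq> 0" using ij assms(4,5) by auto
  ultimately show ?thesis unfolding commensurable_def by blast
qed

text \<open>Along a walk it is enough to cross one edge: a generator of the edge stabilizer fixes
  both ends, as inversions are excluded, and so is a non-trivial element of both vertex
  stabilizers.\<close>

lemma commensurable_elliptic:
  assumes "x \<in> X" "y \<in> X" "a \<in> stabilizer G \<phi> x" "b \<in> stabilizer G \<phi> y" "a \<noteq> \<one>" "b \<noteq> \<one>"
  shows "commensurable G a b"
  using connected[OF assms(1,2)] assms(2,4,6)
proof (induction arbitrary: b)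
  case base
  then show ?case using commensurable_same_vertex assms by blast
next
  case (step y z)
  have e: "{y, z} \<in> E" using step.hyps(2) by (simp add: adjacency_def)
  have X: "y \<in> X" "z \<in> X" using edge_in[OF e] by auto
  obtain c where c: "infinite_order G c"
    "{g \<in> carrier G. \<phi> g ` {y, z} = {y, z}} = range (\<lambda>i::int. c [^] i)"
    using infinite_cyclic_generator[OF edge_stabilizer[OF e]] .
  have "c [^] (1::int) \<in> range (\<lambda>i::int. c [^] i)" by blast
  then have c1: "c \<in> carrier G" "\<phi> c ` {y, z} = {y, z}"
    using c infinite_order_closed by auto
  then have "\<phi> c y = y" "\<phi> c z = z"
    using no_inversion[OF c1(1) e] edge_neq[OF e] by (auto simp: doubleton_eq_iff)
  then have stab: "c \<in> stabilizer G \<phi> y" "c \<in> stabilizer G \<phi> z" using c1 by (auto simp: stab_iff)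
  have ne: "c \<noteq> \<one>"
    using infinite_order_pow_eq[OF c(1), of 1 0] infinite_order_closed[OF c(1)] by auto
  show ?case
  proof (rule commensurable_trans)
    show "commensurable G a c" using step.IH X(1) stab(1) ne by blast
    show "commensurable G c b" using commensurable_same_vertex X(2) stab(2) ne step.prems by blast
  qed (use assms c1 step.prems in \<open>auto simp: stab_iff\<close>)
qed

lemma conj_stab:
  assumes "g \<in> carrier G" "x \<in> X" "a \<in> stabilizer G \<phi> x"
  shows "inv g \<otimes> a \<otimes> g \<in> stabilizer G \<phi> (\<phi> (inv g) x)"
  using assms by (auto simp: stab_iff act_mult phi_in act_inv)

lemma elliptic_commensurated:
  assumes g: "g \<in> carrier G" and a: "x \<in> X" "a \<in> stabilizer G \<phi> x" "a \<noteq> \<one>"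
  obtains m n :: int where "m \<noteq> 0" "n \<noteq> 0" "inv g \<otimes> a [^] m \<otimes> g = a [^] n"
proof -
  have ac: "a \<in> carrier G" using a by (simp add: stab_iff)
  have "inv g \<otimes> a \<otimes> g \<noteq> \<one>"
  proof
    assume "inv g \<otimes> a \<otimes> g = \<one>"
    then have "g \<otimes> (inv g \<otimes> a \<otimes> g) \<otimes> inv g = \<one>" using g by simp
    then have "a = \<one>" using g ac by (simp add: m_assoc)
    with g a(3) show False by simp
  qed
  then have "commensurable G (inv g \<otimes> a \<otimes> g) a"
    using commensurable_elliptic[OF _ a(1) conj_stab[OF g a(1,2)] a(2) _ a(3)] phi_in g a(1) by simp
  then show thesis using that conj_pow[OF g ac] unfolding commensurable_def by metis
qed

section \<open>Groups preserving a line\<close>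

definition reflects :: "'a \<Rightarrow> (int \<Rightarrow> 'v) \<Rightarrow> int \<Rightarrow> bool" where
  "reflects g P s \<longleftrightarrow> (\<forall>i. \<phi> g (P i) = P (s - i))"

text \<open>The induced map on indices is an isometry of the integers, and such a map is determined
  by the images of 0 and 1.\<close>

lemma line_action:
  assumes P: "line P" and c: "c \<in> carrier G" and L: "\<phi> c ` range P \<subseteq> range P"
  obtains s where "translates c P s \<or> reflects c P s"
proof -
  have "\<forall>i. \<exists>j. \<phi> c (P i) = P j" using L by blast
  then obtain f where f: "\<And>i. \<phi> c (P i) = P (f i)" by metis
  have dist: "\<bar>f i - f j\<bar> = \<bar>i - j\<bar>" for i j
    using act_tdist[OF c line_in[OF P, of i] line_in[OF P, of j]] line_tdist[OF P, of i j]
      line_tdist[OF P, of "f i" "f j"] by (simp add: f)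
  have "(\<forall>i. f i = i + f 0) \<or> (\<forall>i. f i = f 0 - i)"
  proof (cases "f 1 = f 0 + 1")
    case True
    have "f i = i + f 0" for i using dist[of i 0] dist[of i 1] True by linarith
    then show ?thesis by blast
  next
    case False
    then have "f 1 = f 0 - 1" using dist[of 1 0] by linarith
    then have "f i = f 0 - i" for i using dist[of i 0] dist[of i 1] by linarith
    then show ?thesis by blast
  qed
  then have "translates c P (f 0) \<or> reflects c P (f 0)"
    unfolding translates_def reflects_def using f by metis
  with that show thesis by blast
qed

text \<open>For odd \<open>s\<close> the element would interchange the ends of the middle edge.
  Hence a reflection always fixes a vertex, the centre \<open>P a\<close>.\<close>

lemma reflects_even:
  assumes P: "line P" and c: "c \<in> carrier G" and s: "reflects c P s"
  obtains a where "s = 2 * a"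
proof (cases "even s")
  case False
  then obtain a where a: "s = 2 * a + 1" by (rule oddE)
  have "{P a, P (a + 1)} \<in> E" using P unfolding line_def by blast
  moreover have "\<phi> c (P a) = P (a + 1)" "\<phi> c (P (a + 1)) = P a"
    using s unfolding reflects_def a by simp_all
  ultimately show thesis using no_inversion[OF c] by blast
qed (use that in blast)

lemma reflects_reflects:
  "\<lbrakk>line P; g \<in> carrier G; h \<in> carrier G; reflects g P s; reflects h P t\<rbrakk> \<Longrightarrow>
     translates (g \<otimes> h) P (s - t)"
  using line_in[of P] unfolding translates_def reflects_def by (simp add: act_mult algebra_simps)

lemma reflects_translates:
  "\<lbrakk>line P; g \<in> carrier G; h \<in> carrier G; reflects g P s; translates h P t\<rbrakk> \<Longrightarrow>
     reflects (g \<otimes> h) P (s - t)"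
  using line_in[of P] unfolding translates_def reflects_def by (simp add: act_mult algebra_simps)

lemma translates_reflects:
  "\<lbrakk>line P; g \<in> carrier G; h \<in> carrier G; translates g P t; reflects h P s\<rbrakk> \<Longrightarrow>
     reflects (g \<otimes> h) P (s + t)"
  using line_in[of P] unfolding translates_def reflects_def by (simp add: act_mult algebra_simps)

lemma reflects_inv:
  assumes "line P" "g \<in> carrier G" "reflects g P s"
  shows "reflects (inv g) P s"
  unfolding reflects_def
proof
  fix i
  have "\<phi> g (P (s - i)) = P i" using assms(3) by (simp add: reflects_def)
  then show "\<phi> (inv g) (P i) = P (s - i)"
    using act_inv(1)[OF assms(2) line_in[OF assms(1), of "s - i"]] by simp
qed

lemma translates_unique: "\<lbrakk>line P; translates g P s; translates g P t\<rbrakk> \<Longrightarrow> s = t"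
proof -
  assume P: "line P" and "translates g P s" "translates g P t"
  then have "P (0 + s) = P (0 + t)" unfolding translates_def by metis
  then show "s = t" using line_inj[OF P] by simp
qed

lemma translates_not_reflects: "\<lbrakk>line P; translates g P t; reflects g P s\<rbrakk> \<Longrightarrow> False"
proof -
  assume P: "line P" and "translates g P t" "reflects g P s"
  then have "P (i + t) = P (s - i)" for i unfolding translates_def reflects_def by metis
  then have "i + t = s - i" for i using line_inj[OF P] by blast
  from this[of 0] this[of 1] show False by simp
qed

lemma translates_one: "line P \<Longrightarrow> translates \<one> P 0"
  using line_in[of P] by (simp add: translates_def phi_one)

text \<open>\<open>w\<close> generates the stabilizer of the centre \<open>P a\<close>, which
  contains \<open>r\<close>. It must itself reflect, as otherwise all its powers, \<open>r\<close>
  among them, would fix the line pointwise; so exactly its even powers do.\<close>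

lemma reflection_generator:
  assumes P: "line P" and L: "\<And>c. c \<in> carrier G \<Longrightarrow> \<phi> c ` range P \<subseteq> range P"
    and r: "r \<in> carrier G" "reflects r P (2 * a)"
  obtains w where "infinite_order G w" "reflects w P (2 * a)"
    "\<And>j. translates (w [^] (2 * j :: int)) P 0"
    "\<And>k. \<lbrakk>k \<in> carrier G; translates k P 0\<rbrakk> \<Longrightarrow> \<exists>j::int. k = w [^] (2 * j)"
proof -
  have X: "P a \<in> X" using line_in[OF P] .
  obtain w where w: "infinite_order G w" "stabilizer G \<phi> (P a) = range (\<lambda>i::int. w [^] i)"
    using stab_generator[OF X] .
  have wc: "w \<in> carrier G" using infinite_order_closed[OF w(1)] .
  have "w [^] (1::int) \<in> stabilizer G \<phi> (P a)" unfolding w(2) by (rule rangeI)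
  then have wa: "\<phi> w (P a) = P a" using wc by (simp add: stab_iff)
  have trans: "translates w P s \<Longrightarrow> s = 0" for s
    using wa line_inj[OF P, of "a + s" a] by (simp add: translates_def)
  have refl: "reflects w P s \<Longrightarrow> s = 2 * a" for s
    using wa line_inj[OF P, of "s - a" a] by (simp add: reflects_def)
  have "\<phi> r (P a) = P a" using r(2) by (simp add: reflects_def)
  then have "r \<in> stabilizer G \<phi> (P a)" using r(1) by (simp add: stab_iff)
  then obtain i :: int where i: "r = w [^] i" unfolding w(2) by blast
  have "\<not> translates w P 0"
  proof
    assume "translates w P 0"
    then have "translates r P (i * 0)" unfolding i by (rule translates_pow[OF P wc])
    then show False using translates_not_reflects[OF P _ r(2)] by blast
  qed
  then have w_refl: "reflects w P (2 * a)"
    using line_action[OF P wc L[OF wc]] trans refl by metis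
  have "translates (w \<otimes> w) P (2 * a - 2 * a)" by (rule reflects_reflects[OF P wc wc w_refl w_refl])
  then have "translates (w [^] (2::int)) P 0" using int_pow_mult[OF wc, of 1 1] wc by simp
  then have ww: "translates ((w [^] (2::int)) [^] j) P (j * 0)" for j :: int
    using wc by (intro translates_pow[OF P]) auto
  then have ww: "translates (w [^] (2 * j)) P 0" for j :: int using wc by (simp add: int_pow_pow)
  have "\<exists>j::int. k = w [^] (2 * j)" if k: "k \<in> carrier G" "translates k P 0" for k
  proof -
    have "\<phi> k (P a) = P a" using k(2) by (simp add: translates_def)
    then have "k \<in> stabilizer G \<phi> (P a)" using k(1) by (simp add: stab_iff)
    then obtain m :: int where m: "k = w [^] m" unfolding w(2) by blast
    have "even m"
    proof (rule ccontr)
      assume "odd m"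
      then obtain j where "m = 2 * j + 1" by (rule oddE)
      then have "k = w [^] (2 * j) \<otimes> w" using m wc by (simp add: int_pow_mult)
      then have "reflects k P (2 * a + 0)"
        using translates_reflects[OF P _ wc ww w_refl] wc by simp
      then show False using translates_not_reflects[OF P k(2)] by blast
    qed
    then show ?thesis using m by blast
  qed
  then show thesis by (rule that[OF w(1) w_refl ww])
qed

text \<open>Without reflections, \<open>G\<close> is generated by a generator of the kernel of the
  action and a shortest translation, which conjugates that generator to itself or its inverse. With
  reflections, the stabilizers of two neighbouring centres have generators \<open>w\<close> and
  \<open>v\<close> with equal squares, and this is the Klein bottle group.\<close>

lemma invariant_line:
  assumes P: "line P" and L: "\<And>c. c \<in> carrier G \<Longrightarrow> \<phi> c ` range P \<subseteq> range P"
    and h: "h \<in> carrier G" "translates h P u" "u \<noteq> 0"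
  shows "G \<cong> integer_group \<times>\<times> integer_group \<or> G \<cong> klein_bottle_group"
proof -
  \<comment> \<open>\<open>n\<close> is to be the least positive translation length, so that it
    divides all others.\<close>
  define Q where "Q = (\<lambda>n::nat. 0 < n \<and> (\<exists>g\<in>carrier G. translates g P (int n)))"
  define n where "n = (LEAST n. Q n)"
  have "Q (nat \<bar>u\<bar>)"
    unfolding Q_def using h translates_inv[OF P h(1,2)] by (cases "0 < u") (auto intro: bexI[of _ "inv h"])
  then have "Q n" unfolding n_def by (rule LeastI)
  then obtain t where n0: "0 < n" and t: "t \<in> carrier G" "translates t P (int n)"
    unfolding Q_def by blast
  have transl_multiple: "int n dvd s" if c: "c \<in> carrier G" "translates c P s" for c s
  proof (rule ccontr)
    assume "\<not> int n dvd s"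
    moreover have "0 \<le> s mod int n" "s mod int n < int n" using n0 by simp_all
    ultimately have m: "0 < nat (s mod int n)" "nat (s mod int n) < n" by (auto simp: dvd_eq_mod_eq_0)
    have "translates (c \<otimes> t [^] (- (s div int n))) P (s + - (s div int n) * int n)"
      using c t by (intro translates_mult[OF P] translates_pow[OF P]) auto
    also have "s + - (s div int n) * int n = int (nat (s mod int n))"
      using \<open>0 \<le> s mod int n\<close> by (simp add: minus_div_mult_eq_mod)
    finally have "Q (nat (s mod int n))" unfolding Q_def using m(1) c t by blast
    then show False using m(2) not_less_Least unfolding n_def by blast
  qed
  have split_trans: "\<exists>q::int. translates (inv (y [^] q) \<otimes> c) P 0"
    if c: "c \<in> carrier G" "translates c P s" and y: "y \<in> carrier G" "translates y P (int n)" for c s y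
  proof -
    obtain q where q: "s = int n * q" using transl_multiple[OF c] by (rule dvdE)
    have "translates (inv (y [^] q)) P (- (q * int n))"
      using y by (intro translates_inv[OF P] translates_pow[OF P]) auto
    then have "translates (inv (y [^] q) \<otimes> c) P (- (q * int n) + s)"
      using c y by (intro translates_mult[OF P]) auto
    then show ?thesis using q by (intro exI[of _ q]) (simp add: mult.commute)
  qed
  show ?thesis
  proof (cases "\<exists>r s. r \<in> carrier G \<and> reflects r P s")
    case False
    have tr: "\<exists>s. translates c P s" if c: "c \<in> carrier G" for c
    proof -
      obtain s where "translates c P s \<or> reflects c P s" using line_action[OF P c L[OF c]] .
      with False c show ?thesis by blast
    qed
    obtain w where w: "infinite_order G w" "stabilizer G \<phi> (P 0) = range (\<lambda>i::int. w [^] i)"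
      using stab_generator[OF line_in[OF P]] .
    have wc: "w \<in> carrier G" using infinite_order_closed[OF w(1)] .
    have ker: "translates c P 0 \<longleftrightarrow> (\<exists>i::int. c = w [^] i)" if c: "c \<in> carrier G" for c
    proof -
      have "translates c P 0 \<longleftrightarrow> c \<in> stabilizer G \<phi> (P 0)"
      proof
        assume "translates c P 0"
        then show "c \<in> stabilizer G \<phi> (P 0)" using c by (simp add: stab_iff translates_def)
      next
        assume *: "c \<in> stabilizer G \<phi> (P 0)"
        obtain s where s: "translates c P s" using tr[OF c] by blast
        then have "P (0 + s) = P 0" using * by (simp add: stab_iff translates_def)
        then show "translates c P 0" using s line_inj[OF P] by simp
      qed
      then show ?thesis unfolding w(2) by blast
    qed
    have w0: "translates w P 0" using ker[OF wc] wc by (metis int_pow_1)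
    have conj0: "translates (inv g \<otimes> w \<otimes> g) P 0" if g: "g \<in> carrier G" "translates g P s" for g s
      using translates_mult[OF P _ g(1) translates_mult[OF P _ wc translates_inv[OF P g] w0] g(2)] g wc
      by simp
    \<comment> \<open>Both \<open>t\<close> and its inverse conjugate \<open>w\<close> to a power of
      \<open>w\<close>; undoing one by the other gives \<open>l * l' = 1\<close>.\<close>
    obtain l :: int where l: "inv (inv t) \<otimes> w \<otimes> inv t = w [^] l"
      using conj0[OF _ translates_inv[OF P t]] ker t wc by (metis inv_closed m_closed)
    obtain l' :: int where l': "inv t \<otimes> w \<otimes> t = w [^] l'"
      using conj0[OF t] ker t wc by (metis inv_closed m_closed)
    have "w = inv (inv t) \<otimes> (inv t \<otimes> w \<otimes> t) \<otimes> inv t" using t wc by (simp add: m_assoc)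
    also have "\<dots> = (w [^] l) [^] l'" unfolding l' using conj_pow[of "inv t" w l'] t wc l by simp
    also have "\<dots> = w [^] (l * l')" using wc by (simp add: int_pow_pow)
    finally have "w [^] (1::int) = w [^] (l * l')" using wc by simp
    then have "l * l' = 1" using infinite_order_pow_eq[OF w(1)] by metis
    then have l1: "l = 1 \<or> l = - 1" using zmult_eq_1_iff by blast
    have rel: "t \<otimes> w \<otimes> inv t = w [^] l" using l t by simp
    have surj: "\<exists>(n::int) (m::int). c = w [^] n \<otimes> t [^] m" if c: "c \<in> carrier G" for c
    proof -
      obtain s where s: "translates c P s" using tr[OF c] by blast
      \<comment> \<open>\<open>inv c\<close> is decomposed in place of \<open>c\<close>, so that
        after inversion the power of \<open>w\<close> stands on the left.\<close>
      obtain q :: int where "translates (inv (t [^] q) \<otimes> inv c) P 0"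
        using split_trans[OF _ translates_inv[OF P c s] t] c by blast
      moreover have "inv (t [^] q) \<otimes> inv c \<in> carrier G" using c t by simp
      ultimately obtain i :: int where i: "inv (t [^] q) \<otimes> inv c = w [^] i" using ker by blast
      have "c = inv (t [^] q \<otimes> w [^] i)" using c t wc by (simp flip: i)
      also have "\<dots> = w [^] (- i) \<otimes> t [^] (- q)" using t wc by (simp add: inv_mult_group int_pow_neg)
      finally show ?thesis by blast
    qed
    have triv: "n' = 0 \<and> m = 0" if *: "w [^] n' \<otimes> t [^] m = \<one>" for n' m :: int
    proof -
      have "translates (w [^] n' \<otimes> t [^] m) P (n' * 0 + m * int n)"
        using t wc w0 by (intro translates_mult[OF P] translates_pow[OF P]) auto
      then have "n' * 0 + m * int n = 0"
        unfolding * using translates_unique[OF P] translates_one[OF P] by blast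
      then have "m = 0" using n0 by simp
      then show ?thesis using * wc infinite_order_pow_eq[OF w(1), of n' 0] by simp
    qed
    from l1 show ?thesis
    proof
      assume "l = 1"
      then have "t \<otimes> w \<otimes> inv t = w" using rel wc by simp
      from iso_free_abelian_2[OF t(1) wc surj triv this] show ?thesis by blast
    next
      assume "l = - 1"
      then have "t \<otimes> w \<otimes> inv t = inv w" using rel wc int_pow_neg[OF wc, of 1] by simp
      from iso_klein_bottle[OF t(1) wc surj triv this] show ?thesis by blast
    qed
  next
    case True
    then obtain r a where r: "r \<in> carrier G" "reflects r P (2 * a)"
      using reflects_even[OF P] by metis
    obtain w where w: "infinite_order G w" "reflects w P (2 * a)"
      "\<And>j. translates (w [^] (2 * j :: int)) P 0"
      "\<And>k. \<lbrakk>k \<in> carrier G; translates k P 0\<rbrakk> \<Longrightarrow> \<exists>j::int. k = w [^] (2 * j)"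
      using reflection_generator[OF P L r] by blast
    have wc: "w \<in> carrier G" using infinite_order_closed[OF w(1)] .
    \<comment> \<open>\<open>w \<otimes> t\<close> reflects in a second centre \<open>P a'\<close>,
      with \<open>2 * a - 2 * a' = int n\<close>.\<close>
    have wt: "w \<otimes> t \<in> carrier G" "reflects (w \<otimes> t) P (2 * a - int n)"
      using reflects_translates[OF P wc t(1) w(2) t(2)] wc t by auto
    obtain a' where a': "2 * a - int n = 2 * a'" using reflects_even[OF P wt] .
    obtain w' where w': "infinite_order G w'" "reflects w' P (2 * a')"
      "\<And>j. translates (w' [^] (2 * j :: int)) P 0"
      "\<And>k. \<lbrakk>k \<in> carrier G; translates k P 0\<rbrakk> \<Longrightarrow> \<exists>j::int. k = w' [^] (2 * j)"
      using reflection_generator[OF P L wt[unfolded a']] by blast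
    have wc': "w' \<in> carrier G" using infinite_order_closed[OF w'(1)] .
    \<comment> \<open>The kernel of the action is generated by the square of \<open>w\<close> and
      also by that of \<open>w'\<close>, so these squares are equal or inverse to each
      other.\<close>
    obtain j :: int where j: "w [^] (2 * 1 :: int) = w' [^] (2 * j)"
      using w'(4)[OF _ w(3)[of 1]] wc by auto
    obtain j' :: int where j': "w' [^] (2 * 1 :: int) = w [^] (2 * j')"
      using w(4)[OF _ w'(3)[of 1]] wc' by auto
    have "w [^] (2 * 1 :: int) = (w' [^] (2 * 1 :: int)) [^] j" using j wc' by (simp add: int_pow_pow)
    also have "\<dots> = w [^] (2 * (j' * j))" unfolding j' using wc by (simp add: int_pow_pow mult.assoc)
    finally have "2 * 1 = 2 * (j' * j)" using infinite_order_pow_eq[OF w(1)] by blast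
    then have "j' * j = 1" by simp
    then have j1: "j = 1 \<or> j = - 1" using zmult_eq_1_iff by blast
    define v where "v = w' [^] j"
    have vc: "v \<in> carrier G" using wc' by (simp add: v_def)
    have v_refl: "reflects v P (2 * a')"
      using j1 w'(2) reflects_inv[OF P wc' w'(2)] wc' int_pow_neg[OF wc', of 1] by (auto simp: v_def)
    have "v \<otimes> v = w' [^] (j + j)" using wc' by (simp only: v_def int_pow_mult)
    also have "\<dots> = w [^] (1 + 1 :: int)" using j by simp
    also have "\<dots> = w \<otimes> w" using wc by (simp only: int_pow_mult int_pow_1)
    finally have sq: "v \<otimes> v = w \<otimes> w" .
    \<comment> \<open>The product of reflections in the two centres translates by
      \<open>2 * a - 2 * a'\<close>, the shortest length \<open>n\<close>, and the equality
      \<open>sq\<close> makes \<open>w\<close> invert it.\<close>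
    define y where "y = inv w \<otimes> v"
    have yc: "y \<in> carrier G" using wc vc by (simp add: y_def)
    have y: "translates y P (int n)"
      using reflects_reflects[OF P _ vc reflects_inv[OF P wc w(2)] v_refl] wc a' by (simp add: y_def algebra_simps)
    have rel: "w \<otimes> y \<otimes> inv w = inv y"
    proof -
      have "v \<otimes> inv w = inv v \<otimes> (v \<otimes> v) \<otimes> inv w" using vc wc by (simp add: m_assoc)
      also have "\<dots> = inv v \<otimes> w" unfolding sq using wc vc by (simp add: m_assoc)
      finally show ?thesis using wc vc by (simp add: y_def inv_mult_group m_assoc)
    qed
    have surj0: "\<exists>(n::int) (j::int). c = y [^] n \<otimes> w [^] (2 * j)"
      if c: "c \<in> carrier G" "translates c P s" for c s
    proof -
      obtain q :: int where q: "translates (inv (y [^] q) \<otimes> c) P 0" using split_trans[OF c yc y] by blast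
      have "inv (y [^] q) \<otimes> c \<in> carrier G" using c yc by simp
      from w(4)[OF this q] obtain j :: int where j: "inv (y [^] q) \<otimes> c = w [^] (2 * j)" by blast
      have "c = y [^] q \<otimes> w [^] (2 * j)" using c yc by (simp flip: j)
      then show ?thesis by blast
    qed
    have surj: "\<exists>(n::int) (m::int). c = y [^] n \<otimes> w [^] m" if c: "c \<in> carrier G" for c
    proof -
      obtain s where "translates c P s \<or> reflects c P s" using line_action[OF P c L[OF c]] .
      then show ?thesis
      proof
        assume "translates c P s"
        then show ?thesis using surj0[OF c] by blast
      next
        assume "reflects c P s"
        then have tr: "translates (c \<otimes> inv w) P (s - 2 * a)"
          using reflects_reflects[OF P c _ _ reflects_inv[OF P wc w(2)]] wc by simp
        then obtain n j :: int where nj: "c \<otimes> inv w = y [^] n \<otimes> w [^] (2 * j)"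
          using surj0[OF _ tr] c wc by blast
        have "c = c \<otimes> inv w \<otimes> w" using c wc by (simp add: m_assoc)
        also have "\<dots> = y [^] n \<otimes> w [^] (2 * j + 1)"
          unfolding nj using wc yc by (simp add: int_pow_mult m_assoc)
        finally show ?thesis by blast
      qed
    qed
    have triv: "n' = 0 \<and> m = 0" if *: "y [^] n' \<otimes> w [^] m = \<one>" for n' m :: int
    proof -
      have tr: "translates (y [^] n' \<otimes> w [^] (2 * j)) P (n' * int n + 0)" for j :: int
        using yc wc y w(3) by (intro translates_mult[OF P] translates_pow[OF P]) auto
      have "even m"
      proof (rule ccontr)
        assume "odd m"
        then obtain j where j: "m = 2 * j + 1" by (rule oddE)
        have "y [^] n' \<otimes> w [^] (2 * j) \<otimes> w = \<one>"
          using * yc wc by (simp add: j int_pow_mult m_assoc)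
        then have "reflects \<one> P (2 * a + (n' * int n + 0))"
          using translates_reflects[OF P _ wc tr[of j] w(2)] yc wc by simp
        then show False using translates_not_reflects[OF P translates_one[OF P]] by blast
      qed
      then obtain j where j: "m = 2 * j" by (rule evenE)
      then have "n' * int n + 0 = 0"
        using tr[of j] translates_unique[OF P _ translates_one[OF P]] unfolding *[unfolded j] by blast
      then have "n' = 0" using n0 by simp
      then show ?thesis using * wc infinite_order_pow_eq[OF w(1), of m 0] by simp
    qed
    from iso_klein_bottle[OF wc yc surj triv rel] show ?thesis by blast
  qed
qed

end

section \<open>Depth with respect to a cyclic subgroup\<close>

context group
begin

text \<open>Finite index puts a positive power of a generator of \<open>K\<close> into
  \<open>H\<close>, so the intersection is a non-trivial subgroup of a cyclic group.\<close>

lemma infinite_cyclic_restrict: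
  assumes K: "infinite_cyclic_subgroup K G" and H: "subgroup H G" "finite (rcosets H)"
  shows "infinite_cyclic_subgroup (K \<inter> H) (G\<lparr>carrier := H\<rparr>)"
proof -
  obtain w where w: "infinite_order G w" "K = range (\<lambda>i::int. w [^] i)"
    using infinite_cyclic_generator[OF K] .
  have wc: "w \<in> carrier G" using infinite_order_closed[OF w(1)] .
  obtain j :: nat where j: "0 < j" "w [^] j \<in> H" using finite_index_pow[OF H wc] .
  have KH: "subgroup (K \<inter> H) G"
    using K H(1) subgroups_Inter_pair by (auto simp: infinite_cyclic_subgroup_def)
  have "w [^] int j \<in> H" using j(2) by (simp add: int_pow_int)
  then have "w [^] int j \<in> K \<inter> H" unfolding w(2) by blast
  moreover have "w [^] int j \<noteq> \<one>" using infinite_order_pow_eq[OF w(1), of "int j" 0] j(1) by auto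
  ultimately have "K \<inter> H \<noteq> {\<one>}" by auto
  then have "infinite_cyclic_subgroup (K \<inter> H) G"
    using w(2) by (intro infinite_cyclic_subgroup_of_cyclic[OF w(1) KH]) auto
  then show ?thesis
    using subgroup_incl[OF KH H(1)] by (simp add: infinite_cyclic_subgroup_def)
qed

lemma finite_rcosets_carrier: "finite (rcosets (carrier G))"
proof -
  have "rcosets (carrier G) \<subseteq> {carrier G}"
    by (auto simp: RCOSETS_def coset_join2 subgroup_self)
  then show ?thesis by (rule finite_subset) simp
qed

lemma subgroup_index_cyclic:
  assumes v: "infinite_order G v" and n: "0 < n"
    and K: "K \<subseteq> range (\<lambda>i::int. v [^] i)" "\<And>l::int. v [^] l \<in> K \<longleftrightarrow> int n dvd l"
  shows "subgroup_index G (range (\<lambda>i::int. v [^] i)) K = n"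
proof -
  have vc: "v \<in> carrier G" using infinite_order_closed[OF v] .
  let ?V = "range (\<lambda>i::int. v [^] i)"
  have mem: "v [^] l \<in> K #> v [^] i \<longleftrightarrow> int n dvd l - i" for l i :: int
  proof
    assume "v [^] l \<in> K #> v [^] i"
    then obtain k where k: "k \<in> K" "v [^] l = k \<otimes> v [^] i" by (auto simp: r_coset_def)
    then obtain j :: int where j: "k = v [^] j" using K(1) by blast
    then have "v [^] l = v [^] (j + i)" using k(2) vc by (simp add: int_pow_mult)
    then have "l - i = j" using infinite_order_pow_eq[OF v] by simp
    then show "int n dvd l - i" using K(2)[of j] k(1) j by simp
  next
    assume "int n dvd l - i"
    then have "v [^] (l - i) \<in> K" using K(2) by simp
    moreover have "v [^] l = v [^] (l - i) \<otimes> v [^] i" using vc by (simp flip: int_pow_mult)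
    ultimately show "v [^] l \<in> K #> v [^] i" by (auto simp: r_coset_def)
  qed
  have sub: "K #> v [^] i \<subseteq> ?V" for i :: int
  proof
    fix x assume "x \<in> K #> v [^] i"
    then obtain k where k: "k \<in> K" "x = k \<otimes> v [^] i" by (auto simp: r_coset_def)
    then obtain j :: int where "k = v [^] j" using K(1) by blast
    then have "x = v [^] (j + i)" using k(2) vc by (simp add: int_pow_mult)
    then show "x \<in> ?V" by blast
  qed
  have coset_eq: "K #> v [^] i = K #> v [^] (i mod int n)" for i :: int
  proof -
    have "v [^] l \<in> K #> v [^] i \<longleftrightarrow> v [^] l \<in> K #> v [^] (i mod int n)" for l :: int
      unfolding mem by (simp add: mod_eq_dvd_iff[symmetric])
    then show ?thesis using sub[of i] sub[of "i mod int n"] by blast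
  qed
  have "rcosets\<^bsub>G\<lparr>carrier := ?V\<rparr>\<^esub> K = (\<lambda>i::int. K #> v [^] i) ` {0..<int n}"
  proof -
    have "rcosets\<^bsub>G\<lparr>carrier := ?V\<rparr>\<^esub> K = range (\<lambda>i::int. K #> v [^] i)"
      by (auto simp: RCOSETS_def r_coset_def)
    also have "\<dots> = (\<lambda>i::int. K #> v [^] i) ` {0..<int n}"
    proof (intro equalityI subsetI)
      fix x assume "x \<in> range (\<lambda>i::int. K #> v [^] i)"
      then obtain i :: int where "x = K #> v [^] i" by blast
      then have "x = K #> v [^] (i mod int n)" using coset_eq by simp
      then show "x \<in> (\<lambda>i::int. K #> v [^] i) ` {0..<int n}"
        by (rule image_eqI) (use n in simp)
    qed blast
    finally show ?thesis .
  qed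
  moreover have "inj_on (\<lambda>i::int. K #> v [^] i) {0..<int n}"
  proof (rule inj_onI)
    fix i j assume ij: "i \<in> {0..<int n}" "j \<in> {0..<int n}" "K #> v [^] i = K #> v [^] j"
    have "v [^] i \<in> K #> v [^] i" unfolding mem by simp
    then have "int n dvd i - j" unfolding ij(3) mem .
    then show "i = j" using ij(1,2) by (simp add: mod_eq_dvd_iff[symmetric])
  qed
  ultimately show ?thesis by (simp add: subgroup_index_def card_image)
qed

lemma subgroup_exponents_of_index:
  assumes v: "infinite_order G v" and K: "subgroup K G" "K \<subseteq> range (\<lambda>i::int. v [^] i)"
    and r: "subgroup_index G (range (\<lambda>i::int. v [^] i)) K = r" "0 < r"
  shows "K = range (\<lambda>i::int. (v [^] int r) [^] i)"
proof -
  let ?V = "range (\<lambda>i::int. v [^] i)"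
  have vc: "v \<in> carrier G" using infinite_order_closed[OF v] .
  have V: "subgroup ?V G" using range_pow_subgroup[OF vc] .
  have "v [^] (1::int) \<in> ?V" by (rule rangeI)
  then have vV: "v \<in> ?V" using vc by simp
  interpret V: group "G\<lparr>carrier := ?V\<rparr>" using subgroup_imp_group[OF V] .
  have fin: "finite (rcosets\<^bsub>G\<lparr>carrier := ?V\<rparr>\<^esub> K)"
    using r by (auto simp: subgroup_index_def intro: card_ge_0_finite)
  have "v \<in> carrier (G\<lparr>carrier := ?V\<rparr>)" using vV by simp
  then obtain j :: nat where j: "0 < j" "v [^]\<^bsub>G\<lparr>carrier := ?V\<rparr>\<^esub> j \<in> K"
    using V.finite_index_pow[OF subgroup_incl[OF K(1) V K(2)] fin] by blast
  then have "v [^] int j \<in> K" "int j \<noteq> 0" by (auto simp: int_pow_int simp flip: nat_pow_consistent)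
  then obtain n :: nat where n: "0 < n" "\<And>k::int. v [^] k \<in> K \<longleftrightarrow> int n dvd k"
    using exponents_of_subgroup[OF vc K(1)] by blast
  have rn: "r = n" using subgroup_index_cyclic[OF v n(1) K(2) n(2)] r(1) by simp
  show ?thesis
  proof (intro equalityI subsetI)
    fix x assume x: "x \<in> K"
    then obtain k :: int where k: "x = v [^] k" using K(2) by blast
    then have "int n dvd k" using x n(2) by blast
    then obtain l where "k = int n * l" by (rule dvdE)
    then have "x = (v [^] int r) [^] l" using k vc rn by (simp add: int_pow_pow)
    then show "x \<in> range (\<lambda>i::int. (v [^] int r) [^] i)" by blast
  next
    fix x assume "x \<in> range (\<lambda>i::int. (v [^] int r) [^] i)"
    then obtain i :: int where "x = v [^] (int n * i)" using vc rn by (auto simp: int_pow_pow)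
    then show "x \<in> K" using n(2)[of "int n * i"] by simp
  qed
qed

end

text \<open>
  For \<open>g\<close> of modulus \<open>\<plusminus>1\<close> conjugation by \<open>g\<close> sends a power of \<open>v\<close> to a power of \<open>v\<close> only if the
  exponents agree up to sign, so the exponents occurring in \<open>V \<inter> V\<^sup>g\<close> are those below.
\<close>

definition preserves_pow :: "('a, 'b) monoid_scheme \<Rightarrow> 'a \<Rightarrow> 'a \<Rightarrow> int \<Rightarrow> bool" where
  "preserves_pow G v g l \<longleftrightarrow>
     inv\<^bsub>G\<^esub> g \<otimes>\<^bsub>G\<^esub> v [^]\<^bsub>G\<^esub> l \<otimes>\<^bsub>G\<^esub> g \<in> {v [^]\<^bsub>G\<^esub> l, v [^]\<^bsub>G\<^esub> (- l)}"

text \<open>With \<open>n = 0\<close> the condition would say that no non-zero power is preserved.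
  Excluding it makes the existence of \<open>n\<close> equivalent to modulus 1 or -1, as shown in
  \<open>depth_profile_eq\<close>.\<close>

definition has_depth :: "('a, 'b) monoid_scheme \<Rightarrow> 'a \<Rightarrow> 'a \<Rightarrow> nat \<Rightarrow> bool" where
  "has_depth G v g n \<longleftrightarrow> 0 < n \<and> (\<forall>l. preserves_pow G v g l \<longleftrightarrow> int n dvd l)"

context group
begin

lemma conj_eq_iff:
  assumes "g \<in> carrier G" "a \<in> carrier G" "b \<in> carrier G"
  shows "inv g \<otimes> a \<otimes> g = b \<longleftrightarrow> a = g \<otimes> b \<otimes> inv g"
proof
  assume "inv g \<otimes> a \<otimes> g = b"
  then show "a = g \<otimes> b \<otimes> inv g" using assms by (auto simp: m_assoc)
next
  assume "a = g \<otimes> b \<otimes> inv g"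
  then show "inv g \<otimes> a \<otimes> g = b" using assms by (simp add: m_assoc)
qed

text \<open>The \<open>k\<close>-th power of the conjugate of \<open>v^l\<close> is the
  \<open>l\<close>-th power of the conjugate of \<open>v^k\<close>, so \<open>j * k\<close> equals
  \<open>k * l\<close> up to sign, and \<open>k\<close> cancels.\<close>

lemma preserves_pow_exponent:
  assumes v: "infinite_order G v" and g: "g \<in> carrier G"
    and k: "preserves_pow G v g k" "k \<noteq> 0" and j: "inv g \<otimes> v [^] (l::int) \<otimes> g = v [^] (j::int)"
  shows "j = l \<or> j = - l"
proof -
  have vc: "v \<in> carrier G" using infinite_order_closed[OF v] .
  have "v [^] (j * k) = (inv g \<otimes> v [^] l \<otimes> g) [^] k" unfolding j using vc by (simp add: int_pow_pow)
  also have "\<dots> = (inv g \<otimes> v [^] k \<otimes> g) [^] l"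
    using vc g by (simp add: conj_pow int_pow_pow mult.commute)
  also have "\<dots> \<in> {v [^] (k * l), v [^] (- k * l)}"
    using k(1) vc by (auto simp: preserves_pow_def int_pow_pow)
  finally have "j * k = k * l \<or> j * k = - k * l" using infinite_order_pow_eq[OF v] by blast
  then have "k * j = k * l \<or> k * j = k * (- l)" by (simp add: mult.commute)
  then show ?thesis using k(2) unfolding mult_left_cancel[OF k(2)] by blast
qed

lemma conjugate_subgroup:
  assumes "subgroup V G" "g \<in> carrier G"
  shows "subgroup (conjugate G V g) G"
    and "x \<in> carrier G \<Longrightarrow> x \<in> conjugate G V g \<longleftrightarrow> inv g \<otimes> x \<otimes> g \<in> V"
proof -
  have Vc: "V \<subseteq> carrier G" using subgroup.subset[OF assms(1)] .
  have mem: "x \<in> conjugate G V g \<longleftrightarrow> inv g \<otimes> x \<otimes> g \<in> V" if x: "x \<in> carrier G" for x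
  proof
    assume "x \<in> conjugate G V g"
    then obtain u where u: "u \<in> V" "x = g \<otimes> u \<otimes> inv g"
      by (auto simp: conjugate_def l_coset_def r_coset_def)
    then have "inv g \<otimes> x \<otimes> g = u" using conj_eq_iff[OF assms(2) x, of u] Vc by blast
    then show "inv g \<otimes> x \<otimes> g \<in> V" using u(1) by simp
  next
    assume *: "inv g \<otimes> x \<otimes> g \<in> V"
    have "x = g \<otimes> (inv g \<otimes> x \<otimes> g) \<otimes> inv g" using x assms(2) by (simp add: m_assoc)
    with * show "x \<in> conjugate G V g" by (auto simp: conjugate_def l_coset_def r_coset_def)
  qed
  then show "x \<in> carrier G \<Longrightarrow> x \<in> conjugate G V g \<longleftrightarrow> inv g \<otimes> x \<otimes> g \<in> V" .
  have sub: "conjugate G V g \<subseteq> carrier G"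
    using Vc assms(2) by (auto simp: conjugate_def l_coset_def r_coset_def)
  show "subgroup (conjugate G V g) G"
  proof (rule subgroupI)
    have "\<one> \<in> conjugate G V g"
      using mem[of \<one>] assms by (simp add: subgroup.one_closed)
    then show "conjugate G V g \<noteq> {}" by blast
  next
    fix a assume a: "a \<in> conjugate G V g"
    then have "inv (inv g \<otimes> a \<otimes> g) \<in> V"
      using mem sub assms(1) by (auto intro: subgroup.m_inv_closed)
    then show "inv a \<in> conjugate G V g"
      using mem[of "inv a"] a sub assms(2) by (auto simp: inv_mult_group m_assoc)
  next
    fix a b assume ab: "a \<in> conjugate G V g" "b \<in> conjugate G V g"
    then have "(inv g \<otimes> a \<otimes> g) \<otimes> (inv g \<otimes> b \<otimes> g) \<in> V"
      using mem sub assms(1) by (auto intro: subgroup.m_closed)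
    moreover have "(inv g \<otimes> a \<otimes> g) \<otimes> (inv g \<otimes> b \<otimes> g) = inv g \<otimes> (a \<otimes> b) \<otimes> g"
      using subsetD[OF sub ab(1)] subsetD[OF sub ab(2)] assms(2) by (simp add: m_assoc)
    ultimately show "a \<otimes> b \<in> conjugate G V g" using mem[of "a \<otimes> b"] ab sub by auto
  qed (rule sub)
qed

lemma preserves_pow_iff_conjugate:
  assumes v: "infinite_order G v" and g: "g \<in> carrier G" and k: "preserves_pow G v g k" "k \<noteq> 0"
  shows "v [^] l \<in> conjugate G (range (\<lambda>i::int. v [^] i)) g \<longleftrightarrow> preserves_pow G v g l"
proof -
  have vc: "v \<in> carrier G" using infinite_order_closed[OF v] .
  have "v [^] l \<in> conjugate G (range (\<lambda>i::int. v [^] i)) g \<longleftrightarrow>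
      inv g \<otimes> v [^] l \<otimes> g \<in> range (\<lambda>i::int. v [^] i)"
    using conjugate_subgroup(2)[OF range_pow_subgroup[OF vc] g] vc by simp
  also have "\<dots> \<longleftrightarrow> preserves_pow G v g l"
    using preserves_pow_exponent[OF v g k, of l] unfolding preserves_pow_def by blast
  finally show ?thesis .
qed

lemma has_depth_exists:
  assumes v: "infinite_order G v" and g: "g \<in> carrier G" and k: "preserves_pow G v g k" "k \<noteq> 0"
  shows "\<exists>n. has_depth G v g n"
proof -
  have vc: "v \<in> carrier G" using infinite_order_closed[OF v] .
  note iff = preserves_pow_iff_conjugate[OF v g k]
  obtain n :: nat where "0 < n"
    "\<And>l::int. v [^] l \<in> conjugate G (range (\<lambda>i::int. v [^] i)) g \<longleftrightarrow> int n dvd l"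
    using exponents_of_subgroup[OF vc conjugate_subgroup(1)[OF range_pow_subgroup[OF vc] g]] iff k
    by metis
  then show ?thesis unfolding has_depth_def iff by blast
qed

lemma depth_eq:
  assumes v: "infinite_order G v" and g: "g \<in> carrier G" and n: "has_depth G v g n"
  shows "depth G (range (\<lambda>i::int. v [^] i)) g = n"
proof -
  have 1: "preserves_pow G v g (int n)" "int n \<noteq> 0" "0 < n" using n by (auto simp: has_depth_def)
  have "v [^] l \<in> range (\<lambda>i::int. v [^] i) \<inter> conjugate G (range (\<lambda>i::int. v [^] i)) g \<longleftrightarrow> int n dvd l"
    for l :: int
    using preserves_pow_iff_conjugate[OF v g 1(1,2), of l] n by (auto simp: has_depth_def)
  from subgroup_index_cyclic[OF v 1(3) _ this] show ?thesis unfolding depth_def by blast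
qed

lemma has_depth_unique: "\<lbrakk>has_depth G v g m; has_depth G v g n\<rbrakk> \<Longrightarrow> m = n"
  unfolding has_depth_def by (metis dvd_antisym dvd_refl int_dvd_int_iff)

lemma preserves_pow_pow:
  "v \<in> carrier G \<Longrightarrow> preserves_pow G (v [^] (r::int)) g l \<longleftrightarrow> preserves_pow G v g (r * l)"
  by (simp add: preserves_pow_def int_pow_pow)

text \<open>This is the formula of (2) for a single element: \<open>n\<close> divides
  \<open>r * l\<close> iff \<open>n / gcd(r, n)\<close> divides \<open>l\<close>.\<close>

lemma has_depth_pow:
  assumes v: "v \<in> carrier G" and n: "has_depth G v g n" and r: "0 < r"
  shows "has_depth G (v [^] int r) g (n div gcd r n)"
proof -
  define d where "d = gcd r n"
  have d: "0 < d" using r by (simp add: d_def)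
  obtain r' n' where rn: "r = d * r'" "n = d * n'" "coprime r' n'"
    using gcd_coprime_exists[of r n] r unfolding d_def by (auto simp: mult.commute)
  have "int n dvd int r * l \<longleftrightarrow> int n' dvd l" for l
  proof -
    have "int n dvd int r * l \<longleftrightarrow> int d * int n' dvd int d * (int r' * l)"
      using rn by (simp add: mult.assoc)
    also have "\<dots> \<longleftrightarrow> int n' dvd int r' * l" using d by simp
    also have "\<dots> \<longleftrightarrow> int n' dvd l"
      using rn(3) by (intro coprime_dvd_mult_right_iff) (simp add: coprime_commute)
    finally show ?thesis .
  qed
  moreover have "n div gcd r n = n'" using rn(2) d unfolding d_def[symmetric] by simp
  moreover have "0 < n'" using n rn(2) by (auto simp: has_depth_def intro: ccontr)
  ultimately show ?thesis using n v by (simp add: has_depth_def preserves_pow_pow)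
qed

text \<open>The multiples of \<open>n\<close> are closed under negation, so the sign changes may be
  iterated. This bounds the depth of a power from above only: it divides \<open>n\<close>.\<close>

lemma preserves_pow_nat_pow:
  assumes v: "v \<in> carrier G" and g: "g \<in> carrier G" and n: "has_depth G v g n" and l: "int n dvd l"
  shows "preserves_pow G v (g [^] (i::nat)) l"
proof (induction i)
  case 0
  then show ?case using v by (simp add: preserves_pow_def)
next
  case (Suc i)
  have "inv (g [^] Suc i) \<otimes> v [^] l \<otimes> g [^] Suc i =
      inv g \<otimes> (inv (g [^] i) \<otimes> v [^] l \<otimes> g [^] i) \<otimes> g"
    using v g by (simp add: inv_mult_group m_assoc)
  moreover have "preserves_pow G v g l" "preserves_pow G v g (- l)"
    using n l by (auto simp: has_depth_def)
  ultimately show ?case using Suc unfolding preserves_pow_def by auto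
qed

lemma commute_preserves_pow:
  assumes "v \<in> carrier G" "g \<in> carrier G" "w \<in> carrier G" "v \<otimes> w = w \<otimes> v"
  shows "preserves_pow G v (g \<otimes> w) l \<longleftrightarrow> preserves_pow G v g l"
proof -
  have "inv w \<otimes> v \<otimes> w = v" using assms by (simp add: m_assoc)
  then have w: "inv w \<otimes> v [^] k \<otimes> w = v [^] k" for k :: int using conj_pow[of w v k] assms by simp
  have eq: "inv (g \<otimes> w) \<otimes> v [^] l \<otimes> (g \<otimes> w) = inv w \<otimes> (inv g \<otimes> v [^] l \<otimes> g) \<otimes> w"
    using assms by (simp add: inv_mult_group m_assoc)
  have "inv w \<otimes> (inv g \<otimes> v [^] l \<otimes> g) \<otimes> w = v [^] k \<longleftrightarrow> inv g \<otimes> v [^] l \<otimes> g = v [^] k" for k :: int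
  proof -
    have "v [^] k = w \<otimes> v [^] k \<otimes> inv w"
      using w[of k] conj_eq_iff[of w "v [^] k" "v [^] k"] assms by simp
    then show ?thesis
      using conj_eq_iff[of w "inv g \<otimes> v [^] l \<otimes> g" "v [^] k"] assms by simp
  qed
  then show ?thesis unfolding preserves_pow_def eq by blast
qed

lemma preserves_pow_restrict:
  assumes H: "subgroup H G" and v: "v \<in> H" and g: "g \<in> H"
  shows "preserves_pow (G\<lparr>carrier := H\<rparr>) v g l \<longleftrightarrow> preserves_pow G v g l"
  using assms by (simp add: preserves_pow_def int_pow_consistent[symmetric])

lemma has_depth_restrict:
  assumes "subgroup H G" "v \<in> H" "g \<in> H"
  shows "has_depth (G\<lparr>carrier := H\<rparr>) v g n \<longleftrightarrow> has_depth G v g n"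
  using assms by (simp add: has_depth_def preserves_pow_restrict)

end

section \<open>Passing to a subgroup of finite index\<close>

context gbs_tree
begin

lemma act_extensional: "g \<in> carrier G \<Longrightarrow> \<phi> g \<in> extensional X"
  using group_hom.hom_closed[OF group_hom] by (auto simp: BijGroup_def Bij_def)

lemma gbs_tree_finite_index:
  assumes H: "subgroup H G" "finite (rcosets H)"
  shows "gbs_tree (G\<lparr>carrier := H\<rparr>) X E \<phi>"
proof -
  have Hc: "g \<in> carrier G" if "g \<in> H" for g using subgroup.mem_carrier[OF H(1) that] .
  have "group_action (G\<lparr>carrier := H\<rparr>) X \<phi>"
    by (rule group_actionI)
      (use subgroup_imp_group[OF H(1)] Hc in \<open>auto simp: act_extensional phi_in phi_one act_mult\<close>)
  moreover have "simplicial_tree X E" by (rule simplicial_tree_axioms)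
  moreover have "gbs_tree_axioms (G\<lparr>carrier := H\<rparr>) X E \<phi>"
  proof
    fix x assume x: "x \<in> X"
    have "stabilizer (G\<lparr>carrier := H\<rparr>) \<phi> x = stabilizer G \<phi> x \<inter> H"
      using Hc by (auto simp: stabilizer_def)
    then show "infinite_cyclic_subgroup (stabilizer (G\<lparr>carrier := H\<rparr>) \<phi> x) (G\<lparr>carrier := H\<rparr>)"
      using infinite_cyclic_restrict[OF vertex_stabilizer[OF x] H] by simp
  next
    fix e assume e: "e \<in> E"
    have "{g \<in> carrier (G\<lparr>carrier := H\<rparr>). \<phi> g ` e = e} = {g \<in> carrier G. \<phi> g ` e = e} \<inter> H"
      using Hc by auto
    then show "infinite_cyclic_subgroup {g \<in> carrier (G\<lparr>carrier := H\<rparr>). \<phi> g ` e = e} (G\<lparr>carrier := H\<rparr>)"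
      using infinite_cyclic_restrict[OF edge_stabilizer[OF e] H] by simp
  qed (use Hc edge_image no_inversion in auto)
  ultimately show ?thesis by (simp add: gbs_tree_def)
qed

lemma elliptic_of_finite_index:
  fixes X' :: "'w set"
  assumes ne: "\<not> elementary G" and H: "subgroup H G" "finite (rcosets H)"
    and T': "gbs_tree (G\<lparr>carrier := H\<rparr>) X' E' \<phi>'" "x' \<in> X'"
    and b: "b \<in> stabilizer (G\<lparr>carrier := H\<rparr>) \<phi>' x'"
  shows "\<exists>x\<in>X. b \<in> stabilizer G \<phi> x"
proof (rule ccontr)
  assume no: "\<not> (\<exists>x\<in>X. b \<in> stabilizer G \<phi> x)"
  interpret T': gbs_tree "G\<lparr>carrier := H\<rparr>" X' E' \<phi>' by (rule T'(1))
  have Hc: "g \<in> carrier G" if "g \<in> H" for g using subgroup.mem_carrier[OF H(1) that] .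
  have bH: "b \<in> H" using b by (simp add: stabilizer_def)
  have bc: "b \<in> carrier G" using Hc[OF bH] .
  have free: "\<phi> b x \<noteq> x" if "x \<in> X" for x using no bc that by (auto simp: stab_iff)
  have b1: "b \<noteq> \<one>" using free nonempty phi_one by blast
  obtain P t where P: "line P" and t: "translates b P t" "0 < t" using axis_exists[OF bc free] by blast
  have axis_pow: "axis (b [^] k) = range P" if "k \<noteq> 0" for k :: int
    using axis_translation[OF P _ translates_pow[OF P bc t(1)]] bc that t(2) by simp
  \<comment> \<open>As \<open>b\<close> is elliptic in the other tree, \<open>h\<close> conjugates
    some \<open>b^m\<close> to some \<open>b^n\<close> with non-zero exponents, and both powers have
    axis \<open>range P\<close>.\<close>
  have H_line: "\<phi> h ` range P = range P" if h: "h \<in> H" for h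
  proof -
    have ih: "inv h \<in> H" using h H(1) by (simp add: subgroup.m_inv_closed)
    have "b \<noteq> \<one>\<^bsub>G\<lparr>carrier := H\<rparr>\<^esub>" using b1 by simp
    then obtain m n :: int where mn: "m \<noteq> 0" "n \<noteq> 0" "h \<otimes> b [^] m \<otimes> inv h = b [^] n"
      using T'.elliptic_commensurated[of "inv h" x' b] ih h Hc[OF h] T'(2) b bH H(1)
      by (auto simp: int_pow_consistent[symmetric])
    have "\<phi> h ` axis (b [^] m) = axis (b [^] n)"
      using axis_conj[OF Hc[OF h], of "b [^] m"] mn(3) bc by simp
    then show ?thesis using axis_pow mn by simp
  qed
  have "\<phi> c ` range P \<subseteq> range P" if c: "c \<in> carrier G" for c
  proof -
    have cb: "c \<otimes> b \<otimes> inv c \<in> carrier G" using c bc by simp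
    \<comment> \<open>\<open>c\<close> need not lie in \<open>H\<close>, but a power
      \<open>h\<close> of the conjugate of \<open>b\<close> does. So \<open>h\<close> preserves the
      line and, having no fixed vertex, translates it; its axis, the image of \<open>range P\<close>
      under \<open>c\<close>, is then \<open>range P\<close>.\<close>
    obtain j :: nat where j: "0 < j" "(c \<otimes> b \<otimes> inv c) [^] j \<in> H" using finite_index_pow[OF H cb] .
    define h where "h = (c \<otimes> b \<otimes> inv c) [^] j"
    have hH: "h \<in> H" using j(2) by (simp add: h_def)
    have h_eq: "h = c \<otimes> b [^] int j \<otimes> inv c"
      using conj_pow[of "inv c" b "int j"] c bc by (simp add: h_def int_pow_int)
    have h_free: "\<phi> h x \<noteq> x" if x: "x \<in> X" for x
    proof
      assume "\<phi> h x = x"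
      then have "\<phi> (inv c) (\<phi> h x) = \<phi> (inv c) x" by simp
      then have "\<phi> (b [^] int j) (\<phi> (inv c) x) = \<phi> (inv c) x"
        using c bc x by (simp add: h_eq act_mult phi_in act_inv)
      then show False using free_pow[OF bc free, of "int j"] j(1) phi_in c x by simp
    qed
    obtain s where s: "translates h P s \<or> reflects h P s"
      using line_action[OF P Hc[OF hH]] H_line[OF hH] by blast
    have "\<not> reflects h P s"
    proof
      assume r: "reflects h P s"
      then obtain a where "s = 2 * a" using reflects_even[OF P Hc[OF hH]] by blast
      then have "\<phi> h (P a) = P a" using r by (simp add: reflects_def)
      then show False using h_free[OF line_in[OF P]] by blast
    qed
    then have s: "translates h P s" using s by blast
    have "s \<noteq> 0"
    proof
      assume "s = 0"
      then have "\<phi> h (P 0) = P 0" using s by (simp add: translates_def)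
      then show False using h_free[OF line_in[OF P]] by blast
    qed
    then have "axis h = range P" using axis_translation[OF P Hc[OF hH] s] by blast
    moreover have "axis h = \<phi> c ` axis (b [^] int j)" unfolding h_eq using axis_conj[OF c] bc by simp
    ultimately show ?thesis using axis_pow[of "int j"] j(1) by simp
  qed
  then have "G \<cong> integer_group \<times>\<times> integer_group \<or> G \<cong> klein_bottle_group"
    using invariant_line[OF P _ bc t(1)] t(2) by blast
  with ne show False by (auto simp: elementary_def)
qed

section \<open>The modular homomorphism and depth\<close>

text \<open>Every witness in the definite description gives the same ratio, because any two
  non-trivial elliptic elements have a common non-trivial power.\<close>

lemma modular_eq:
  assumes ell: "\<And>a. elliptic G a \<Longrightarrow> \<exists>x\<in>X. a \<in> stabilizer G \<phi> x"
    and v: "elliptic G v" "v \<noteq> \<one>" and g: "g \<in> carrier G"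
    and mn: "m \<noteq> 0" "n \<noteq> 0" "inv g \<otimes> v [^] (m::int) \<otimes> g = v [^] (n::int)"
  shows "modular G g = of_int m / of_int n"
  unfolding modular_def
proof (rule the_equality)
  show "\<exists>a (m' :: int) (n' :: int). elliptic G a \<and> a \<noteq> \<one> \<and> m' \<noteq> 0 \<and> n' \<noteq> 0 \<and>
     inv g \<otimes> (a [^] m') \<otimes> g = a [^] n' \<and>
     rat_of_int m / rat_of_int n = rat_of_int m' / rat_of_int n'"
    using v mn by blast
next
  fix r assume "\<exists>a (m' :: int) (n' :: int). elliptic G a \<and> a \<noteq> \<one> \<and> m' \<noteq> 0 \<and> n' \<noteq> 0 \<and>
     inv g \<otimes> (a [^] m') \<otimes> g = a [^] n' \<and> r = rat_of_int m' / rat_of_int n'"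
  then obtain a and m' n' :: int where a: "elliptic G a" "a \<noteq> \<one>" "m' \<noteq> 0" "n' \<noteq> 0"
    "inv g \<otimes> (a [^] m') \<otimes> g = a [^] n'" "r = rat_of_int m' / rat_of_int n'" by blast
  obtain x where x: "x \<in> X" "v \<in> stabilizer G \<phi> x" using ell[OF v(1)] by blast
  obtain y where y: "y \<in> X" "a \<in> stabilizer G \<phi> y" using ell[OF a(1)] by blast
  have vi: "infinite_order G v" using elliptic_infinite_order[OF x v(2)] .
  have c: "v \<in> carrier G" "a \<in> carrier G" using x y by (auto simp: stab_iff)
  have "commensurable G v a" using commensurable_elliptic[OF x(1) y(1) x(2) y(2) v(2) a(2)] .
  then obtain s t :: int where st: "s \<noteq> 0" "t \<noteq> 0" "v [^] s = a [^] t"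
    unfolding commensurable_def by blast
  \<comment> \<open>The conjugate of \<open>v^(s * m * m')\<close>, which is
    \<open>a^(t * m * m')\<close>, is evaluated through \<open>v\<close> and through
    \<open>a\<close>.\<close>
  have "v [^] (n * (s * m')) = (inv g \<otimes> v [^] m \<otimes> g) [^] (s * m')"
    unfolding mn(3) using c by (simp add: int_pow_pow)
  also have "\<dots> = inv g \<otimes> (v [^] s) [^] (m * m') \<otimes> g"
    using c g by (simp add: conj_pow int_pow_pow algebra_simps)
  also have "\<dots> = inv g \<otimes> (a [^] m') [^] (t * m) \<otimes> g"
    unfolding st(3) using c by (simp add: int_pow_pow algebra_simps)
  also have "\<dots> = (inv g \<otimes> a [^] m' \<otimes> g) [^] (t * m)" using c g by (simp add: conj_pow)
  also have "\<dots> = (a [^] t) [^] (n' * m)" unfolding a(5) using c by (simp add: int_pow_pow algebra_simps)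
  also have "\<dots> = v [^] (s * (n' * m))" unfolding st(3)[symmetric] using c by (simp add: int_pow_pow)
  finally have "n * (s * m') = s * (n' * m)" using infinite_order_pow_eq[OF vi] by blast
  then have "s * (m' * n) = s * (m * n')" by (simp add: algebra_simps)
  then have "m' * n = m * n'" using st(1) by simp
  then have "rat_of_int m' * rat_of_int n = rat_of_int m * rat_of_int n'"
    by (simp flip: of_int_mult)
  then show "r = rat_of_int m / rat_of_int n" using mn(2) a(4,6) by (simp add: frac_eq_eq)
qed

text \<open>Removes \<open>modular\<close> and \<open>depth\<close> from the problem: what remains
  are elements without fixed vertices and divisibility of preserved exponents.\<close>

lemma depth_profile_eq:
  assumes ell: "\<And>a. elliptic G a \<Longrightarrow> \<exists>x\<in>X. a \<in> stabilizer G \<phi> x"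
    and v: "elliptic G v" "v \<noteq> \<one>"
  shows "depth_profile G (range (\<lambda>i::int. v [^] i)) = {n. \<exists>g. hyperbolic G g \<and> has_depth G v g n}"
proof -
  obtain x where x: "x \<in> X" "v \<in> stabilizer G \<phi> x" using ell[OF v(1)] by blast
  have vi: "infinite_order G v" using elliptic_infinite_order[OF x v(2)] .
  have mod: "modular G g = 1 \<or> modular G g = - 1 \<longleftrightarrow> (\<exists>n. has_depth G v g n)"
    if g: "g \<in> carrier G" for g
  proof
    assume *: "modular G g = 1 \<or> modular G g = - 1"
    obtain m n :: int where mn: "m \<noteq> 0" "n \<noteq> 0" "inv g \<otimes> v [^] m \<otimes> g = v [^] n"
      using elliptic_commensurated[OF g x v(2)] .
    have "rat_of_int m / rat_of_int n = 1 \<or> rat_of_int m / rat_of_int n = - 1"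
      using * modular_eq[OF ell v g mn] by simp
    then have "rat_of_int m = rat_of_int n \<or> rat_of_int m = rat_of_int (- n)"
      using mn(2) by (auto simp: field_simps)
    then have "n = m \<or> n = - m" unfolding of_int_eq_iff by auto
    then have "preserves_pow G v g m" using mn(3) by (auto simp: preserves_pow_def)
    then show "\<exists>n. has_depth G v g n" using has_depth_exists[OF vi g] mn(1) by blast
  next
    assume "\<exists>n. has_depth G v g n"
    then obtain n where n: "0 < n" "preserves_pow G v g (int n)" by (auto simp: has_depth_def)
    then have "inv g \<otimes> v [^] int n \<otimes> g = v [^] int n \<or> inv g \<otimes> v [^] int n \<otimes> g = v [^] (- int n)"
      by (auto simp: preserves_pow_def)
    then show "modular G g = 1 \<or> modular G g = - 1"
      using modular_eq[OF ell v g, of "int n" "int n"] modular_eq[OF ell v g, of "int n" "- int n"] n(1)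
      by auto
  qed
  show ?thesis
    unfolding depth_profile_def
  proof (intro equalityI subsetI)
    fix n assume "n \<in> {depth G (range (\<lambda>i::int. v [^] i)) g |g. hyperbolic G g \<and> (modular G g = 1 \<or> modular G g = - 1)}"
    then obtain g where g: "n = depth G (range (\<lambda>i::int. v [^] i)) g" "hyperbolic G g"
      "modular G g = 1 \<or> modular G g = - 1" by blast
    have gc: "g \<in> carrier G" using g(2) by (simp add: hyperbolic_def)
    obtain n' where "has_depth G v g n'" using g(3) mod[OF gc] by blast
    then show "n \<in> {n. \<exists>g. hyperbolic G g \<and> has_depth G v g n}"
      using g(1,2) depth_eq[OF vi gc] by auto
  next
    fix n assume "n \<in> {n. \<exists>g. hyperbolic G g \<and> has_depth G v g n}"
    then obtain g where g: "hyperbolic G g" "has_depth G v g n" by blast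
    have gc: "g \<in> carrier G" using g(1) by (simp add: hyperbolic_def)
    show "n \<in> {depth G (range (\<lambda>i::int. v [^] i)) g |g. hyperbolic G g \<and> (modular G g = 1 \<or> modular G g = - 1)}"
      using g mod[OF gc] depth_eq[OF vi gc g(2)] by blast
  qed
qed

text \<open>
  Replacing \<open>g\<close> by \<open>g \<otimes> w\<close> with \<open>w\<close> generating the stabilizer of a vertex \<open>y\<close> fixed by \<open>v\<close> does not
  change the depth. If \<open>y\<close> minimizes the displacement over all such replacements, one of \<open>g\<close>,
  \<open>g \<otimes> w\<close> has \<open>y\<close> on its axis, and then all its positive powers have the same depth.
\<close>

lemma hyperbolic_of_depth_in_finite_index:
  assumes x: "x \<in> X" "v \<in> stabilizer G \<phi> x" and v1: "v \<noteq> \<one>"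
    and g: "g \<in> carrier G" "\<And>x. x \<in> X \<Longrightarrow> \<phi> g x \<noteq> x" and n: "has_depth G v g n"
    and H: "subgroup H G" "finite (rcosets H)"
  shows "\<exists>h\<in>H. (\<forall>x\<in>X. \<phi> h x \<noteq> x) \<and> has_depth G v h n"
proof (cases "n = 1")
  \<comment> \<open>For depth 1 any power of \<open>g\<close> will do, since its depth divides
    1.\<close>
  case True
  have vc: "v \<in> carrier G" using x(2) by (simp add: stab_iff)
  obtain j :: nat where j: "0 < j" "g [^] j \<in> H" using finite_index_pow[OF H g(1)] .
  have "has_depth G v (g [^] j) n"
    using preserves_pow_nat_pow[OF vc g(1) n] by (simp add: has_depth_def True)
  moreover have "\<phi> (g [^] j) x \<noteq> x" if "x \<in> X" for x
    using free_pow[OF g _ that, of "int j"] j(1) by (simp add: int_pow_int)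
  ultimately show ?thesis using j(2) by blast
next
  case n1: False
  have vc: "v \<in> carrier G" using x(2) by (simp add: stab_iff)
  have vi: "infinite_order G v" using elliptic_infinite_order[OF x v1] .
  \<comment> \<open>The fixed vertex and the element vary together. \<open>A\<close> keeps the depth
    but does not ask for hyperbolicity: \<open>n \<noteq> 1\<close> will show that \<open>y\<close>
    is moved, and the element finally chosen is hyperbolic as a translation.\<close>
  define A where "A = (\<lambda>y g. y \<in> X \<and> \<phi> v y = y \<and> g \<in> carrier G \<and> has_depth G v g n)"
  define N where "N = (LEAST N. \<exists>y g. A y g \<and> tdist y (\<phi> g y) = N)"
  have "\<exists>N y g. A y g \<and> tdist y (\<phi> g y) = N"
    using x g(1) n by (intro exI[of _ "tdist x (\<phi> g x)"] exI[of _ x] exI[of _ g]) (simp add: A_def stab_iff)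
  then have "\<exists>y g. A y g \<and> tdist y (\<phi> g y) = N" unfolding N_def by (rule LeastI_ex)
  then obtain y g where yg: "A y g" "tdist y (\<phi> g y) = N" by blast
  have min: "N \<le> tdist z (\<phi> k z)" if "A z k" for z k
    unfolding N_def using that by (intro Least_le) blast
  have y: "y \<in> X" "\<phi> v y = y" and gc: "g \<in> carrier G" and gn: "has_depth G v g n"
    using yg(1) by (auto simp: A_def)
  obtain w where w: "infinite_order G w" "stabilizer G \<phi> y = range (\<lambda>i::int. w [^] i)"
    using stab_generator[OF y(1)] .
  have wc: "w \<in> carrier G" using infinite_order_closed[OF w(1)] .
  have v_stab: "v \<in> stabilizer G \<phi> y" using y vc by (simp add: stab_iff)
  then obtain s :: int where s: "v = w [^] s" unfolding w(2) by blast
  have comm: "v \<otimes> w [^] i = w [^] i \<otimes> v" for i :: int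
    unfolding s using wc by (simp add: add.commute flip: int_pow_mult)
  have w_y: "\<phi> w y = y"
  proof -
    have "w [^] (1::int) \<in> stabilizer G \<phi> y" unfolding w(2) by (rule rangeI)
    then show ?thesis using wc by (simp add: stab_iff)
  qed
  \<comment> \<open>Otherwise \<open>g\<close> and \<open>v\<close> would lie in one cyclic group
    and commute, forcing depth 1.\<close>
  have "\<phi> g y \<noteq> y"
  proof
    assume "\<phi> g y = y"
    then have "g \<in> stabilizer G \<phi> y" using gc by (simp add: stab_iff)
    then obtain i :: int where "g = w [^] i" unfolding w(2) by blast
    then have "v \<otimes> g = g \<otimes> v" using comm by simp
    then have "inv g \<otimes> v \<otimes> g = v" using vc gc by (simp add: m_assoc)
    then have "preserves_pow G v g 1" using vc by (simp add: preserves_pow_def)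
    then have "int n dvd 1" using gn by (simp add: has_depth_def)
    with n1 show False by simp
  qed
  then obtain y1 where y1: "{y, y1} \<in> E" "tdist y (\<phi> g y) = Suc (tdist y1 (\<phi> g y))"
    using closer_neighbor[OF y(1) phi_in[OF gc y(1)]] by metis
  have gwc: "g \<otimes> w \<in> carrier G" using gc wc by simp
  have gw_y: "\<phi> (g \<otimes> w) y = \<phi> g y" using gc wc y(1) w_y by (simp add: act_mult)
  have gw_n: "has_depth G v (g \<otimes> w) n"
    using gn commute_preserves_pow[OF vc gc wc] comm[of 1] wc by (simp add: has_depth_def)
  have y1X: "y1 \<in> X" using edge_in[OF y1(1)] by simp
  \<comment> \<open>If both backtrack, \<open>g\<close> and \<open>g \<otimes> w\<close> agree on
    \<open>y1\<close>, so \<open>w\<close> and hence \<open>v\<close> fix \<open>y1\<close>. Then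
    \<open>y1\<close> with \<open>g\<close> has smaller displacement than the minimum.\<close>
  have not_both: "\<not> (tdist (\<phi> g y) y = Suc (tdist (\<phi> g y1) y) \<and>
      tdist (\<phi> g y) y = Suc (tdist (\<phi> (g \<otimes> w) y1) y))"
  proof
    assume *: "tdist (\<phi> g y) y = Suc (tdist (\<phi> g y1) y) \<and>
      tdist (\<phi> g y) y = Suc (tdist (\<phi> (g \<otimes> w) y1) y)"
    have "{\<phi> g y, \<phi> g y1} \<in> E" "{\<phi> g y, \<phi> (g \<otimes> w) y1} \<in> E"
      using act_edge[OF gc y1(1)] act_edge[OF gwc y1(1)] gw_y by auto
    then have "\<phi> g y1 = \<phi> (g \<otimes> w) y1" using closer_neighbor_unique[OF _ _ y(1)] * by blast
    then have "\<phi> g y1 = \<phi> g (\<phi> w y1)" using gc wc y1X by (simp add: act_mult)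
    then have "\<phi> w y1 = y1" using act_eq_iff[OF gc y1X phi_in[OF wc y1X]] by simp
    then have "\<phi> v y1 = y1" unfolding s using act_int_pow_fix wc y1X by blast
    then have "A y1 g" unfolding A_def using y1X gc gn by blast
    then show False using min backtracking_shortens[OF gc y1] * yg(2) by fastforce
  qed
  obtain h where h: "h \<in> carrier G" "has_depth G v h n" "\<phi> h y = \<phi> g y"
    "tdist (\<phi> h y) y \<noteq> Suc (tdist (\<phi> h y1) y)"
    using not_both gc gn gwc gw_n gw_y by metis
  obtain P where P: "line P" "P 0 = y" "translates h P (int N)"
    using line_from_nonbacktracking[OF h(1) y1(1) _ h(4)] y1(2) yg(2) unfolding h(3) by metis
  have N0: "0 < N" using y1(2) yg(2) by simp
  obtain j :: nat where j: "0 < j" "h [^] j \<in> H" using finite_index_pow[OF H h(1)] .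
  have hj: "h [^] j \<in> carrier G" using h(1) by simp
  have hj_t: "translates (h [^] j) P (int j * int N)"
    using translates_pow[OF P(1) h(1) P(3), of "int j"] by (simp add: int_pow_int)
  have free: "\<phi> (h [^] j) x \<noteq> x" if "x \<in> X" for x
    using translation_no_fixed_vertex[OF P(1) hj hj_t _ that] j(1) N0 by simp
  have "preserves_pow G v (h [^] j) l \<longleftrightarrow> int n dvd l" for l
  proof
    assume "int n dvd l"
    then show "preserves_pow G v (h [^] j) l" using preserves_pow_nat_pow[OF vc h(1,2)] by blast
  next
    assume "preserves_pow G v (h [^] j) l"
    then obtain l' where l': "inv (h [^] j) \<otimes> v [^] l \<otimes> h [^] j = v [^] (l'::int)"
      by (auto simp: preserves_pow_def)
    have v_fix: "\<phi> (v [^] k) y = y" for k :: int using act_int_pow_fix[OF vc y] .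
    have "v [^] l = h [^] j \<otimes> v [^] l' \<otimes> inv (h [^] j)" using l' conj_eq_iff[OF hj] vc by blast
    then have "\<phi> (v [^] l) (\<phi> (h [^] j) y) = \<phi> (h [^] j) y"
      using hj vc y(1) v_fix by (simp add: act_mult phi_in act_inv)
    moreover have "\<phi> (h [^] j) y = P (int j * int N)" using hj_t P(2) by (metis add_0 translates_def)
    \<comment> \<open>\<open>v^l\<close> fixes \<open>P 0 = y\<close> and the image of
      \<open>y\<close> under \<open>h^j\<close>. The image under \<open>h\<close> lies between them
      because \<open>j\<close> is positive.\<close>
    ultimately have "\<phi> (v [^] l) (P (int N)) = P (int N)"
      using fixes_between[OF P(1), of "v [^] l" 0 "int j * int N" "int N"] vc v_fix P(2) j(1) N0 by simp
    moreover have "P (int N) = \<phi> h y" using P(2,3) by (metis add_0 translates_def)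
    ultimately have "\<phi> (inv h \<otimes> v [^] l \<otimes> h) y = y"
      using h(1) vc y(1) by (simp add: act_mult phi_in act_inv)
    then have "inv h \<otimes> v [^] l \<otimes> h \<in> stabilizer G \<phi> y" using h(1) vc by (simp add: stab_iff)
    then obtain i :: int where i: "inv h \<otimes> v [^] l \<otimes> h = w [^] i" unfolding w(2) by blast
    have n0: "0 < n" "preserves_pow G v h (int n)" using h(2) by (auto simp: has_depth_def)
    then obtain e :: int where e: "inv h \<otimes> v [^] int n \<otimes> h = v [^] (e * int n)" "e = 1 \<or> e = - 1"
      unfolding preserves_pow_def by (metis insertE mult_1 mult_minus1 singletonD)
    \<comment> \<open>Raising to the power \<open>n\<close> allows a comparison with the known
      action of \<open>h\<close> on \<open>v^n\<close>; cancelling \<open>n\<close> in the exponents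
      of \<open>w\<close> identifies \<open>w^i\<close> as \<open>v^l\<close> or its
      inverse.\<close>
    have "w [^] (i * int n) = (inv h \<otimes> v [^] l \<otimes> h) [^] int n" unfolding i using wc by (simp add: int_pow_pow)
    also have "\<dots> = (inv h \<otimes> v [^] int n \<otimes> h) [^] l"
      using vc h(1) by (simp add: conj_pow int_pow_pow mult.commute)
    also have "\<dots> = w [^] (s * (e * int n) * l)" unfolding e(1) unfolding s
      using wc by (simp add: int_pow_pow algebra_simps)
    finally have "i * int n = s * (e * int n) * l" using infinite_order_pow_eq[OF w(1)] by blast
    then have "int n * i = int n * (s * (e * l))" by (simp add: algebra_simps)
    then have "i = s * (e * l)" using n0(1) by simp
    then have "w [^] i = v [^] (e * l)" unfolding s using wc by (simp add: int_pow_pow)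
    then have "inv h \<otimes> v [^] l \<otimes> h = v [^] (e * l)" using i by simp
    then have "preserves_pow G v h l" using e(2) by (auto simp: preserves_pow_def)
    then show "int n dvd l" using h(2) by (simp add: has_depth_def)
  qed
  then have "has_depth G v (h [^] j) n" using n by (simp add: has_depth_def)
  then show ?thesis using j(2) free by blast
qed

end

text \<open>One tree of \<open>G\<close> tests ellipticity in every subgroup of finite index: it is
  a GBS tree for \<open>H\<close> too, and \<open>elliptic_of_finite_index\<close> handles all other
  trees of \<open>H\<close>.\<close>

lemma elliptic_finite_index_iff:
  fixes G :: "('a, 'b) monoid_scheme" and X :: "'a set"
  assumes T: "gbs_tree G X E \<phi>" and ne: "\<not> elementary G"
    and H: "subgroup H G" "finite (rcosets\<^bsub>G\<^esub> H)"
  shows "elliptic (G\<lparr>carrier := H\<rparr>) g \<longleftrightarrow> g \<in> H \<and> (\<exists>x\<in>X. g \<in> stabilizer G \<phi> x)"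
proof -
  interpret gbs_tree G X E \<phi> by (rule T)
  show ?thesis
  proof
    assume "elliptic (G\<lparr>carrier := H\<rparr>) g"
    then obtain X' :: "'a set" and E' \<phi>' x' where T': "gbs_tree (G\<lparr>carrier := H\<rparr>) X' E' \<phi>'"
      "x' \<in> X'" "g \<in> stabilizer (G\<lparr>carrier := H\<rparr>) \<phi>' x'" unfolding elliptic_def by blast
    then show "g \<in> H \<and> (\<exists>x\<in>X. g \<in> stabilizer G \<phi> x)"
      using elliptic_of_finite_index[OF ne H T'] by (simp add: stabilizer_def)
  next
    assume "g \<in> H \<and> (\<exists>x\<in>X. g \<in> stabilizer G \<phi> x)"
    then obtain x where "x \<in> X" "g \<in> stabilizer (G\<lparr>carrier := H\<rparr>) \<phi> x"
      by (auto simp: stabilizer_def)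
    with gbs_tree_finite_index[OF H] show "elliptic (G\<lparr>carrier := H\<rparr>) g"
      unfolding elliptic_def by blast
  qed
qed

text \<open>The case of \<open>G\<close> as a subgroup of itself, which gives independence of the
  tree.\<close>

lemma elliptic_iff:
  fixes G :: "('a, 'b) monoid_scheme" and X :: "'a set"
  assumes T: "gbs_tree G X E \<phi>" and ne: "\<not> elementary G"
  shows "elliptic G g \<longleftrightarrow> (\<exists>x\<in>X. g \<in> stabilizer G \<phi> x)"
proof -
  interpret gbs_tree G X E \<phi> by (rule T)
  have "elliptic (G\<lparr>carrier := carrier G\<rparr>) g \<longleftrightarrow> g \<in> carrier G \<and> (\<exists>x\<in>X. g \<in> stabilizer G \<phi> x)"
    by (rule elliptic_finite_index_iff[OF T ne subgroup_self finite_rcosets_carrier])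
  then show ?thesis by (auto simp: stabilizer_def)
qed

theorem theorem5p1:
  fixes G :: "('a, 'b) monoid_scheme" and V :: "'a set"
  assumes "gbs_group G" and "\<not> elementary G"
    and "elliptic_subgroup V G" and "V \<noteq> {\<one>\<^bsub>G\<^esub>}"
  shows "(\<forall>G'. subgroup G' G \<longrightarrow> finite (rcosets\<^bsub>G\<^esub> G') \<longrightarrow> V \<subseteq> G' \<longrightarrow>
            depth_profile G V = depth_profile (G\<lparr>carrier := G'\<rparr>) V) \<and>
         (\<forall>V' r. subgroup V' G \<longrightarrow> V' \<subseteq> V \<longrightarrow> r > 0 \<longrightarrow> subgroup_index G V V' = r \<longrightarrow>
            depth_profile G V' = {n div gcd r n | n. n \<in> depth_profile G V})"
proof -
  obtain X :: "'a set" and E \<phi> x where T: "gbs_tree G X E \<phi>" and x: "x \<in> X" "V \<subseteq> stabilizer G \<phi> x"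
    and V: "subgroup V G"
    using assms(3) unfolding elliptic_subgroup_def by blast
  interpret gbs_tree G X E \<phi> by (rule T)
  note ell = elliptic_iff[OF T assms(2)]
  obtain w where w: "infinite_order G w" "stabilizer G \<phi> x = range (\<lambda>i::int. w [^]\<^bsub>G\<^esub> i)"
    using stab_generator[OF x(1)] .
  have "infinite_cyclic_subgroup V G"
    using infinite_cyclic_subgroup_of_cyclic[OF w(1) V] x(2) w(2) assms(4) by simp
  then obtain v where v: "infinite_order G v" "V = range (\<lambda>i::int. v [^]\<^bsub>G\<^esub> i)"
    by (rule infinite_cyclic_generator)
  have vc: "v \<in> carrier G" using infinite_order_closed[OF v(1)] .
  have "v [^]\<^bsub>G\<^esub> (1::int) \<in> V" unfolding v(2) by (rule rangeI)
  then have vV: "v \<in> V" using vc by simp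
  have v1: "u \<noteq> \<one>\<^bsub>G\<^esub>" if "infinite_order G u" for u
    using infinite_order_pow_eq[OF that, of 1 0] infinite_order_closed[OF that] by auto
  have v_stab: "v \<in> stabilizer G \<phi> x" using vV x(2) by blast
  have D: "depth_profile G (range (\<lambda>i::int. u [^]\<^bsub>G\<^esub> i)) = {n. \<exists>g. hyperbolic G g \<and> has_depth G u g n}"
    if "u \<in> stabilizer G \<phi> x" "infinite_order G u" for u
    by (rule depth_profile_eq) (use ell that x(1) v1 in blast)+
  show ?thesis
  proof (intro conjI allI impI)
    fix G' assume H: "subgroup G' G" "finite (rcosets\<^bsub>G\<^esub> G')" and VG': "V \<subseteq> G'"
    let ?G' = "G\<lparr>carrier := G'\<rparr>"
    interpret T': gbs_tree ?G' X E \<phi> by (rule gbs_tree_finite_index[OF H])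
    note ell' = elliptic_finite_index_iff[OF T assms(2) H]
    have vG': "v \<in> G'" using vV VG' by blast
    have hyp': "hyperbolic ?G' g \<longleftrightarrow> g \<in> G' \<and> hyperbolic G g" for g
      using subgroup.mem_carrier[OF H(1)] by (auto simp: hyperbolic_def ell' ell)
    have "V = range (\<lambda>i::int. v [^]\<^bsub>?G'\<^esub> i)"
      unfolding v(2) using int_pow_consistent[OF H(1) vG'] by simp
    moreover have "depth_profile ?G' (range (\<lambda>i::int. v [^]\<^bsub>?G'\<^esub> i)) =
        {n. \<exists>g. hyperbolic ?G' g \<and> has_depth ?G' v g n}"
    proof (rule T'.depth_profile_eq)
      show "\<exists>x\<in>X. a \<in> stabilizer ?G' \<phi> x" if "elliptic ?G' a" for a
        using that unfolding ell' by (auto simp: stabilizer_def)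
      show "elliptic ?G' v" unfolding ell' using vG' v_stab x(1) by blast
    qed (use v1[OF v(1)] in simp)
    ultimately have D': "depth_profile ?G' V = {n. \<exists>g\<in>G'. hyperbolic G g \<and> has_depth G v g n}"
      using has_depth_restrict[OF H(1) vG'] hyp' by auto
    \<comment> \<open>The substantial inclusion of (1): a depth realized in \<open>G\<close> is
      realized inside \<open>G'\<close>, in general by a different element.\<close>
    have "\<exists>h\<in>G'. hyperbolic G h \<and> has_depth G v h n" if g: "hyperbolic G g" "has_depth G v g n" for g n
    proof -
      have gc: "g \<in> carrier G" and "\<phi> g z \<noteq> z" if "z \<in> X" for z
        using g(1) that by (auto simp: hyperbolic_def ell stab_iff)
      then obtain h where h: "h \<in> G'" "\<forall>x\<in>X. \<phi> h x \<noteq> x" "has_depth G v h n"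
        using hyperbolic_of_depth_in_finite_index[OF x(1) v_stab v1[OF v(1)] _ _ g(2) H] x(1) by blast
      then have "hyperbolic G h"
        using subgroup.mem_carrier[OF H(1)] by (auto simp: hyperbolic_def ell stab_iff)
      with h show ?thesis by blast
    qed
    then show "depth_profile G V = depth_profile ?G' V"
      using D[OF v_stab v(1)] unfolding D' v(2)[symmetric] by blast
  next
    fix V' :: "'a set" and r :: nat
    assume V': "subgroup V' G" "V' \<subseteq> V" and r: "0 < r" "subgroup_index G V V' = r"
    have V'_eq: "V' = range (\<lambda>i::int. (v [^]\<^bsub>G\<^esub> int r) [^]\<^bsub>G\<^esub> i)"
      using subgroup_exponents_of_index[OF v(1) V'(1) _ _ r(1)] V'(2) r(2) unfolding v(2) by blast
    have vr: "v [^]\<^bsub>G\<^esub> int r \<in> stabilizer G \<phi> x" "infinite_order G (v [^]\<^bsub>G\<^esub> int r)"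
      using x(2) v(2) infinite_order_pow[OF v(1), of "int r"] r(1) by auto
    have "has_depth G (v [^]\<^bsub>G\<^esub> int r) g m \<longleftrightarrow> (\<exists>n. has_depth G v g n \<and> m = n div gcd r n)"
      if g: "g \<in> carrier G" for g m
    proof
      \<comment> \<open>An exponent \<open>m\<close> preserved for \<open>v^r\<close> gives the
        exponent \<open>r * m\<close> for \<open>v\<close>. So \<open>g\<close> has some depth
        \<open>n\<close> with respect to \<open>v\<close>, and uniqueness of depth yields the
        formula for \<open>m\<close>.\<close>
      assume m: "has_depth G (v [^]\<^bsub>G\<^esub> int r) g m"
      then have "preserves_pow G v g (int r * int m)" "0 < m"
        using vc by (auto simp: has_depth_def simp flip: preserves_pow_pow)
      then obtain n where n: "has_depth G v g n" using has_depth_exists[OF v(1) g] r(1) by fastforce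
      then show "\<exists>n. has_depth G v g n \<and> m = n div gcd r n"
        using has_depth_unique[OF m has_depth_pow[OF vc n r(1)]] by blast
    next
      assume "\<exists>n. has_depth G v g n \<and> m = n div gcd r n"
      then show "has_depth G (v [^]\<^bsub>G\<^esub> int r) g m" using has_depth_pow[OF vc _ r(1)] by blast
    qed
    then have "{m. \<exists>g. hyperbolic G g \<and> has_depth G (v [^]\<^bsub>G\<^esub> int r) g m} =
        {n div gcd r n |n. \<exists>g. hyperbolic G g \<and> has_depth G v g n}"
      unfolding hyperbolic_def by blast
    then show "depth_profile G V' = {n div gcd r n |n. n \<in> depth_profile G V}"
      using D[OF vr] D[OF v_stab v(1)] unfolding V'_eq v(2)[symmetric] by simp
  qed
qed

end
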